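(* Let $(X,d)$ be a metric space supporting a Borel probability measure $\mu$, let $T\colon X\to X$ be an invertible, measure-preserving transformation, fix $m\in\mathbb{N}$, and let $C\colon X\times\mathbb{Z}\to\mathrm{GL}(m,\mathbb{R})$ be a measurable cocycle over $T$. Let $(A_N)_{N\in\mathbb{N}}$ be a sequence of real numbers, let $\mathcal{V}=(V_N)_{N\in\mathbb{N}}$ be a sequence of positive real numbers with $V_N\to\infty$ as $N\to\infty$, and let $S$ be a real random variable. Assume that the random variables \[ S_N(x,v):=\frac{\sigma(x,v,N)-A_N}{V_N}\quad\text{on }(X\times\mathbb{P}\mathbb{R}^m,\mu\otimes\nu) \] converge in distribution to $S$ as $N\to\infty$, i.e. for every interval $(a,b)\subseteq\mathbb{R}$ with $\mathbb{P}(S\in\{a,b\})=0$, \[ \lim_{N\to\infty}(\mu\otimes\nu)(\{(x,v)\in X\times\mathbb{P}\mathbb{R}^m : S_N(x,v)\in(a,b)\})=\mathbb{P}(S\in(a,b)). \] Assume that $C$ is $\mathcal{V}$-sufficiently-bounded and has $\mathcal{V}$-simple-dominated-splitting. Assume in addition that there exist a measure-preserving, ergodic transformation $U\colon X\to X$ and a measurable cocycle $D\colon X\times\mathbb{N}\to\mathrm{GL}(m,\mathbb{R})$ over $U$ such that $(T,U)$ is contracting and $(C,D)$ is $(T,U,\mathcal{V})$-adapted. Then for every pair of Borel measurable subsets $A,B\subseteq X$ and every interval $(a,b)\subseteq\mathbb{R}$ with $\mathbb{P}(S\in\{a,b\})=0$, \[ \lim_{N\to\infty}(\mu\otimes\nu)(\{(x,v)\in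 X\times\mathbb{P}\mathbb{R}^m : x\in A,\ S_N(x,v)\in(a,b),\ T^Nx\in B\})=\mu(A)\cdot\mathbb{P}(S\in(a,b))\cdot\mu(B). \]
   Context: A cocycle over $T$ is a map $C\colon X\times\mathbb{Z}\to\mathrm{GL}(m,\mathbb{R})$ with $C(x,r+s)=C(T^rx,s)\cdot C(x,r)$ for $\mu$-almost every $x\in X$ and every $r,s\in\mathbb{Z}$; a cocycle $D\colon X\times\mathbb{N}\to\mathrm{GL}(m,\mathbb{R})$ over $U$ is defined by the same identity with $U$ in place of $T$ and $r,s\in\mathbb{N}$. $\|\cdot\|$ is the Euclidean norm on $\mathbb{R}^m$ and $\nu$ is the probability measure it induces on the projective space $\mathbb{P}\mathbb{R}^m$ (the rotation-invariant one). For $x\in X$, $v\in\mathbb{R}^m\setminus\{0\}$ or $v\in\mathbb{P}\mathbb{R}^m$ (using any nonzero representative), and $N\in\mathbb{N}$, put $\sigma(x,v,N):=\log\frac{\|C(x,N)v\|}{\|v\|}$. In the following, $o_{x,v}(V_N)$ (and similarly with other subscripts) denotes a quantity whose ratio to $V_N$ tends to $0$ as $N\to\infty$, at a rate that may depend on the subscripts. $C$ is $\mathcal{V}$-sufficiently-bounded if for $\mu$-almost every $x\in X$ and $\nu$-almost every $v\in\mathbb{P}\mathbb{R}^m$, $|\sigma(x,v,N)-\sigma(Tx,C(x,1)v,N)|=o_{x,v}(V_N)$. $C$ has $\mathcal{V}$-simple-dominated-splitting if for $\mu$-almost every $x\in X$ and $\nu$-almost every $v,w\in\mathbb{P}\mathbb{R}^m$,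 $|\sigma(x,v,N)-\sigma(x,w,N)|=o_{x,v,w}(V_N)$. $(T,U)$ is contracting if $\lim_{n\to\infty}d(T^nUx,T^nx)=0$ for $\mu$-almost every $x\in X$. $(C,D)$ is $(T,U,\mathcal{V})$-adapted if for $\mu$-almost every $x\in X$ and $\nu$-almost every $v\in\mathbb{P}\mathbb{R}^m$, $|\sigma(x,v,N)-\sigma(Ux,D(x,1)v,N)|=o_{x,v}(V_N)$. *)

theory Defs
  imports "HOL-Probability.Probability"
begin

section \<open>Real projective space and its rotation-invariant probability measure\<close>

definition proportional :: "real^'m::finite \<Rightarrow> real^'m \<Rightarrow> bool" where
  "proportional v w \<longleftrightarrow> v \<noteq> 0 \<and> w \<noteq> 0 \<and> (\<exists>c. c \<noteq> 0 \<and> w = c *\<^sub>R v)"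

lemma part_equivp_proportional: "part_equivp (proportional :: real^'m::finite \<Rightarrow> _)"
proof (rule part_equivpI)
  have "proportional (axis undefined 1 :: real^'m) (axis undefined 1)"
    unfolding proportional_def by (auto simp: axis_eq_0_iff intro!: exI[of _ "1::real"])
  then show "\<exists>v :: real^'m. proportional v v" by blast
  show "symp (proportional :: real^'m \<Rightarrow> _)"
  proof (rule sympI)
    fix v w :: "real^'m" assume "proportional v w"
    then obtain c where c: "v \<noteq> 0" "w \<noteq> 0" "c \<noteq> 0" "w = c *\<^sub>R v"
      unfolding proportional_def by blast
    then have "v = inverse c *\<^sub>R w" by simp
    with c show "proportional w v"
      unfolding proportional_def by (metis nonzero_imp_inverse_nonzero)
  qed
  show "transp (proportional :: real^'m \<Rightarrow> _)"
  proof (rule transpI)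
    fix u v w :: "real^'m" assume "proportional u v" "proportional v w"
    then obtain c d where "u \<noteq> 0" "w \<noteq> 0" "c \<noteq> 0" "v = c *\<^sub>R u" "d \<noteq> 0" "w = d *\<^sub>R v"
      unfolding proportional_def by blast
    then show "proportional u w"
      unfolding proportional_def by (intro conjI exI[of _ "d * c"]) auto
  qed
qed

quotient_type (overloaded) 'm projective = "real^'m::finite" / partial: proportional
  morphisms rep_projective proj_class
  by (rule part_equivp_proportional)

text \<open>The quotient topology; \<open>borel\<close> on \<open>'m projective\<close> is its Borel sigma-algebra.\<close>

instantiation projective :: (finite) topological_space
begin

definition open_projective :: "'a projective set \<Rightarrow> bool" where
  "open_projective U \<longleftrightarrow> open {v. v \<noteq> 0 \<and> proj_class v \<in> U}"

instance
proof
  have "{v :: real^'a. v \<noteq> 0} = - {0}" by auto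
  then show "open (UNIV :: 'a projective set)"
    unfolding open_projective_def by (simp add: open_Compl)
next
  fix S T :: "'a projective set"
  assume "open S" "open T"
  moreover have "{v. v \<noteq> 0 \<and> proj_class v \<in> S \<inter> T} =
      {v. v \<noteq> 0 \<and> proj_class v \<in> S} \<inter> {v. v \<noteq> 0 \<and> proj_class v \<in> T}" by auto
  ultimately show "open (S \<inter> T)" unfolding open_projective_def by (simp add: open_Int)
next
  fix K :: "'a projective set set"
  assume "\<forall>S\<in>K. open S"
  moreover have "{v. v \<noteq> 0 \<and> proj_class v \<in> \<Union>K} = (\<Union>S\<in>K. {v. v \<noteq> 0 \<and> proj_class v \<in> S})"
    by auto
  ultimately show "open (\<Union>K)" unfolding open_projective_def by (simp add: open_UN)
qed

end

text \<open>
  The rotation-invariant probability measure, realised as the radial push-forward of the uniform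
  distribution on the Euclidean unit ball. The value of \<open>proj_class\<close> at the origin (a null set) is
  irrelevant.
\<close>

definition proj_measure :: "'m::finite projective measure" where
  "proj_measure = distr (uniform_measure lborel (ball 0 1)) borel proj_class"

text \<open>The action of \<open>GL(m,\<real>)\<close>; the value at a singular matrix is a dummy.\<close>

lift_definition proj_act :: "real^'m^'m \<Rightarrow> 'm::finite projective \<Rightarrow> 'm projective"
  is "\<lambda>A v. if invertible A then A *v v else v"
proof -
  fix A :: "real^'m^'m" and v w :: "real^'m" assume vw: "proportional v w"
  then obtain c where c: "v \<noteq> 0" "w \<noteq> 0" "c \<noteq> 0" "w = c *\<^sub>R v"
    unfolding proportional_def by blast
  show "proportional (if invertible A then A *v v else v) (if invertible A then A *v w else w)"
  proof (cases "invertible A")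
    case True
    then have "inj ((*v) A)" by (simp add: inj_matrix_vector_mult)
    then have "A *v v \<noteq> 0" "A *v w \<noteq> 0"
      using c by (metis injD matrix_vector_mult_0_right)+
    moreover have "A *v w = c *\<^sub>R (A *v v)"
      using c by (simp add: matrix_vector_mult_scaleR)
    ultimately show ?thesis using True c unfolding proportional_def by auto
  qed (use vw in simp)
qed

subsection \<open>\<open>proj_measure\<close> is a rotation-invariant probability measure\<close>

lemma proj_class_measurable [measurable]:
  "(proj_class :: real^'m::finite \<Rightarrow> _) \<in> borel_measurable borel"
proof (rule borel_measurableI)
  fix U :: "'m projective set" assume "open U"
  then have "{v. v \<noteq> 0 \<and> proj_class v \<in> U} \<in> sets borel" by (simp add: open_projective_def)
  moreover have "proj_class -` U \<inter> space borel =
      {v. v \<noteq> 0 \<and> proj_class v \<in> U} \<union> (if proj_class 0 \<in> U then {0} else {})"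
    by auto
  ultimately show "proj_class -` U \<inter> space borel \<in> sets borel" by auto
qed

lemma prob_space_proj_measure: "prob_space (proj_measure :: 'm::finite projective measure)"
proof -
  have "\<not> unit_ball_vol (real CARD('m)) \<le> 0"
    using unit_ball_vol_pos[of "real CARD('m)"] by linarith
  then have "emeasure lborel (ball (0::real^'m) 1) \<noteq> 0" "emeasure lborel (ball (0::real^'m) 1) \<noteq> \<infinity>"
    by (auto simp: emeasure_ball ennreal_eq_0_iff)
  then have "prob_space (uniform_measure lborel (ball 0 1 :: (real^'m) set))"
    by (rule prob_space_uniform_measure)
  then show ?thesis
    unfolding proj_measure_def by (rule prob_space.prob_space_distr) simp
qed

lemma proj_act_class:
  assumes "invertible A" "v \<noteq> 0"
  shows "proj_act A (proj_class v) = proj_class (A *v v)"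
proof -
  have "proportional v v"
    using assms unfolding proportional_def by (auto intro!: exI[of _ "1::real"])
  then show ?thesis using assms by (simp add: proj_act.abs_eq eq_onp_def)
qed

lemma nn_integral_lborel_translate:
  fixes f :: "'a::euclidean_space \<Rightarrow> ennreal"
  assumes [measurable]: "f \<in> borel_measurable borel"
  shows "(\<integral>\<^sup>+x. f (c + x) \<partial>lborel) = (\<integral>\<^sup>+x. f x \<partial>lborel)"
proof -
  have "(\<integral>\<^sup>+x. f x \<partial>lborel) = (\<integral>\<^sup>+x. f x \<partial>distr lborel borel ((+) c))"
    by (simp add: lborel_distr_plus)
  also have "\<dots> = (\<integral>\<^sup>+x. f (c + x) \<partial>lborel)"
    by (rule nn_integral_distr) auto
  finally show ?thesis by simp
qed

lemma nn_integral_lborel_reflect: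
  fixes f :: "'a::euclidean_space \<Rightarrow> ennreal"
  assumes [measurable]: "f \<in> borel_measurable borel"
  shows "(\<integral>\<^sup>+x. f (c - x) \<partial>lborel) = (\<integral>\<^sup>+x. f x \<partial>lborel)"
proof -
  have "(\<integral>\<^sup>+x. f x \<partial>lborel) = (\<integral>\<^sup>+x. f x \<partial>distr lborel borel (\<lambda>x. c + (- 1) *\<^sub>R x))"
    by (subst lborel_affine[of "-1" c]) (simp_all add: density_1)
  also have "\<dots> = (\<integral>\<^sup>+x. f (c - x) \<partial>lborel)"
    by (subst nn_integral_distr) simp_all
  finally show ?thesis by simp
qed

text \<open>The library states this only for well-ordered index types.\<close>

lemma lborel_orthogonal_invariant:
  fixes Q :: "real^'m::finite^'m"
  assumes Q: "orthogonal_matrix Q"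
  shows "distr lborel borel ((*v) Q) = lborel"
proof (rule measure_eqI)
  fix E assume "E \<in> sets (distr lborel borel ((*v) Q))"
  then have E [measurable]: "E \<in> sets borel" by simp
  define B where "B = ball (0::real^'m) 1"
  have B [measurable]: "B \<in> sets borel" by (simp add: B_def)
  have Qm [measurable]: "(\<lambda>x. Q *v x) \<in> borel_measurable borel"
    by (intro borel_measurable_continuous_onI matrix_vector_mult_linear_continuous_on)
  have Q1: "Q *v (transpose Q *v y) = y" for y
    using Q by (metis orthogonal_matrix_def matrix_vector_mul_assoc matrix_vector_mul_lid)
  have nQ: "norm (Q *v x) = norm x" for x
    using Q by (intro orthogonal_transformation_norm)
      (simp add: orthogonal_transformation_matrix matrix_of_matrix_vector_mul)
  let ?e = "indicator E :: real^'m \<Rightarrow> ennreal" and ?b = "indicator B :: real^'m \<Rightarrow> ennreal"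
  interpret pair_sigma_finite "lborel :: (real^'m) measure" "lborel :: (real^'m) measure" ..
  have "(\<integral>\<^sup>+x. ?e (Q *v x) \<partial>lborel) * emeasure lborel B
      = (\<integral>\<^sup>+x. ?e (Q *v x) * (\<integral>\<^sup>+y. ?b y \<partial>lborel) \<partial>lborel)"
    by (simp add: nn_integral_multc)
  also have "\<dots> = (\<integral>\<^sup>+x. ?e (Q *v x) * (\<integral>\<^sup>+y. ?b (Q *v x + y) \<partial>lborel) \<partial>lborel)"
    by (subst nn_integral_lborel_translate[of ?b]) auto
  also have "\<dots> = (\<integral>\<^sup>+x. (\<integral>\<^sup>+y. ?e (Q *v x) * ?b (Q *v x + y) \<partial>lborel) \<partial>lborel)"
    by (simp add: nn_integral_cmult)
  also have "\<dots> = (\<integral>\<^sup>+y. (\<integral>\<^sup>+x. ?e (Q *v x) * ?b (Q *v x + y) \<partial>lborel) \<partial>lborel)"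
    by (rule lborel_pair.Fubini') measurable
  also have "\<dots> = (\<integral>\<^sup>+y. (\<integral>\<^sup>+x. ?e (Q *v x - y) * ?b (Q *v x) \<partial>lborel) \<partial>lborel)"
  proof (rule nn_integral_cong)
    fix y :: "real^'m"
    obtain z where z: "Q *v z = y" using Q1 by blast
    have "(\<integral>\<^sup>+x. ?e (Q *v x) * ?b (Q *v x + y) \<partial>lborel)
        = (\<integral>\<^sup>+x. ?e (Q *v (- z + x)) * ?b (Q *v (- z + x) + y) \<partial>lborel)"
      by (rule nn_integral_lborel_translate[symmetric]) measurable
    then show "(\<integral>\<^sup>+x. ?e (Q *v x) * ?b (Q *v x + y) \<partial>lborel)
        = (\<integral>\<^sup>+x. ?e (Q *v x - y) * ?b (Q *v x) \<partial>lborel)"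
      by (simp add: matrix_vector_mult_diff_distrib z)
  qed
  also have "\<dots> = (\<integral>\<^sup>+x. (\<integral>\<^sup>+y. ?e (Q *v x - y) * ?b (Q *v x) \<partial>lborel) \<partial>lborel)"
    by (rule lborel_pair.Fubini') measurable
  also have "\<dots> = (\<integral>\<^sup>+x. (\<integral>\<^sup>+y. ?e (Q *v x - y) \<partial>lborel) * ?b (Q *v x) \<partial>lborel)"
    by (simp add: nn_integral_multc)
  also have "\<dots> = (\<integral>\<^sup>+x. emeasure lborel E * ?b x \<partial>lborel)"
    by (subst nn_integral_lborel_reflect[of ?e]) (auto simp: B_def nQ indicator_def)
  also have "\<dots> = emeasure lborel E * emeasure lborel B"
    by (simp add: nn_integral_cmult)
  finally have eq: "(\<integral>\<^sup>+x. ?e (Q *v x) \<partial>lborel) * emeasure lborel B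
      = emeasure lborel E * emeasure lborel B" .
  have "\<not> unit_ball_vol (real CARD('m)) \<le> 0"
    using unit_ball_vol_pos[of "real CARD('m)"] by linarith
  then have "emeasure lborel B \<noteq> 0" "emeasure lborel B \<noteq> \<top>"
    by (auto simp: B_def emeasure_ball ennreal_eq_0_iff)
  with eq have "(\<integral>\<^sup>+x. ?e (Q *v x) \<partial>lborel) = emeasure lborel E"
    by (metis ennreal_mult_cancel_left mult.commute)
  moreover have "emeasure (distr lborel borel ((*v) Q)) E = (\<integral>\<^sup>+x. ?e (Q *v x) \<partial>lborel)"
    by (subst nn_integral_indicator[symmetric], simp, subst nn_integral_distr) auto
  ultimately show "emeasure (distr lborel borel ((*v) Q)) E = emeasure lborel E" by simp
qed simp

lemma proj_act_measurable [measurable]: "proj_act A \<in> borel_measurable borel"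
proof (cases "invertible A")
  case True
  then have inj: "inj ((*v) A)" by (simp add: inj_matrix_vector_mult)
  have nz: "A *v v \<noteq> 0" if "v \<noteq> 0" for v
    using inj that by (metis injD matrix_vector_mult_0_right)
  show ?thesis
  proof (rule borel_measurable_continuous_onI)
    show "continuous_on UNIV (proj_act A)"
      unfolding continuous_on_open_vimage[OF open_UNIV]
    proof safe
      fix U :: "'a projective set" assume "open U"
      then have "open ((*v) A -` {v. v \<noteq> 0 \<and> proj_class v \<in> U})"
        unfolding open_projective_def
        by (intro open_vimage matrix_vector_mult_linear_continuous_on)
      also have "(*v) A -` {v. v \<noteq> 0 \<and> proj_class v \<in> U}
          = {v. v \<noteq> 0 \<and> proj_class v \<in> proj_act A -` U \<inter> UNIV}"
      proof (intro set_eqI)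
        fix v
        show "v \<in> (*v) A -` {v. v \<noteq> 0 \<and> proj_class v \<in> U} \<longleftrightarrow>
            v \<in> {v. v \<noteq> 0 \<and> proj_class v \<in> proj_act A -` U \<inter> UNIV}"
          using nz[of v] proj_act_class[OF True, of v] by (cases "v = 0") simp_all
      qed
      finally show "open (proj_act A -` U \<inter> UNIV)"
        unfolding open_projective_def .
    qed
  qed
next
  case False
  then have "proj_act A = (\<lambda>v. v)"
    by (intro ext, transfer) (auto simp: proportional_def)
  then show ?thesis by simp
qed

lemma proj_measure_invariant:
  fixes Q :: "real^'m::finite^'m"
  assumes Q: "orthogonal_matrix Q"
  shows "distr proj_measure borel (proj_act Q) = proj_measure"
proof (rule measure_eqI)
  fix E :: "'m projective set" assume "E \<in> sets (distr proj_measure borel (proj_act Q))"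
  then have E [measurable]: "E \<in> sets borel" by simp
  have Qm [measurable]: "(\<lambda>x. Q *v x) \<in> borel_measurable borel"
    by (intro borel_measurable_continuous_onI matrix_vector_mult_linear_continuous_on)
  have inv: "invertible Q"
    using Q by (auto simp: orthogonal_matrix_def invertible_def)
  have nQ: "norm (Q *v x) = norm x" for x
    using Q by (intro orthogonal_transformation_norm)
      (simp add: orthogonal_transformation_matrix matrix_of_matrix_vector_mul)
  let ?u = "uniform_measure lborel (ball (0::real^'m) 1)"
  have sets: "F \<in> sets borel \<Longrightarrow> proj_class -` F \<in> sets borel" for F :: "'m projective set"
    using measurable_sets[OF proj_class_measurable, of F] by simp
  have PE: "proj_act Q -` E \<in> sets borel"
    using measurable_sets[OF proj_act_measurable, of E Q] by simp
  have em: "emeasure proj_measure F =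
      emeasure lborel (ball 0 1 \<inter> proj_class -` F) / emeasure lborel (ball (0::real^'m) 1)"
    if "F \<in> sets borel" for F :: "'m projective set"
    using that sets[OF that] by (simp add: proj_measure_def emeasure_distr)
  have "emeasure lborel (ball 0 1 \<inter> proj_class -` E)
      = emeasure (distr lborel borel ((*v) Q)) (ball 0 1 \<inter> proj_class -` E)"
    by (simp add: lborel_orthogonal_invariant[OF Q])
  also have "\<dots> = emeasure lborel ((*v) Q -` (ball 0 1 \<inter> proj_class -` E))"
    using sets[OF E] by (subst emeasure_distr) auto
  also have "\<dots> = emeasure lborel (ball 0 1 \<inter> proj_class -` (proj_act Q -` E))"
  proof (rule emeasure_eq_AE)
    show "AE x in lborel. (x \<in> (*v) Q -` (ball 0 1 \<inter> proj_class -` E)) =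
        (x \<in> ball 0 1 \<inter> proj_class -` (proj_act Q -` E))"
      using AE_lborel_singleton[of 0] by eventually_elim (auto simp: nQ proj_act_class[OF inv])
    show "(*v) Q -` (ball 0 1 \<inter> proj_class -` E) \<in> sets lborel"
      using measurable_sets[OF Qm, of "ball 0 1 \<inter> proj_class -` E"] sets[OF E] by simp
    show "ball 0 1 \<inter> proj_class -` (proj_act Q -` E) \<in> sets lborel"
      using sets[OF PE] by simp
  qed
  finally have "emeasure proj_measure (proj_act Q -` E) = emeasure proj_measure E"
    by (simp add: em PE)
  then show "emeasure (distr proj_measure borel (proj_act Q)) E = emeasure proj_measure E"
    by (subst emeasure_distr) (auto simp: proj_measure_def)
qed (simp add: proj_measure_def)

section \<open>Dynamics\<close>

definition measure_preserving :: "'a measure \<Rightarrow> ('a \<Rightarrow> 'a) \<Rightarrow> bool" where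
  "measure_preserving M T \<longleftrightarrow> T \<in> measurable M M \<and> distr M M T = M"

definition ergodic :: "'a measure \<Rightarrow> ('a \<Rightarrow> 'a) \<Rightarrow> bool" where
  "ergodic M T \<longleftrightarrow>
     (\<forall>E\<in>sets M. T -` E \<inter> space M = E \<longrightarrow> measure M E = 0 \<or> measure M E = measure M (space M))"

definition int_iterate :: "('a \<Rightarrow> 'a) \<Rightarrow> int \<Rightarrow> 'a \<Rightarrow> 'a" where
  "int_iterate T r = (if r \<ge> 0 then T ^^ nat r else inv T ^^ nat (- r))"

text \<open>
  Here \<open>\<Phi> r\<close> is the \<open>r\<close>-th power of the base map: \<open>\<Phi> = int_iterate T\<close> for cocycles indexed by
  the integers and \<open>\<Phi> r = U ^^ r\<close> for cocycles indexed by the natural numbers.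
\<close>

definition measurable_cocycle ::
    "'a measure \<Rightarrow> ('r::monoid_add \<Rightarrow> 'a \<Rightarrow> 'a) \<Rightarrow> ('a \<Rightarrow> 'r \<Rightarrow> real^'m^'m::finite) \<Rightarrow> bool" where
  "measurable_cocycle M \<Phi> C \<longleftrightarrow>
     (\<lambda>(x, r). C x r) \<in> borel_measurable (M \<Otimes>\<^sub>M count_space UNIV) \<and>
     (\<forall>x\<in>space M. \<forall>r. invertible (C x r)) \<and>
     (AE x in M. \<forall>r s. C x (r + s) = C (\<Phi> r x) s ** C x r)"

text \<open>
  \<open>\<sigma>(x,v,N)\<close>. The quotient does not depend on the representative of \<open>v\<close>.
\<close>

lift_definition log_growth ::
    "('a \<Rightarrow> int \<Rightarrow> real^'m^'m) \<Rightarrow> 'a \<Rightarrow> 'm::finite projective \<Rightarrow> nat \<Rightarrow> real"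
  is "\<lambda>C x v N. ln (norm (C x (int N) *v v) / norm v)"
  by (auto simp: proportional_def matrix_vector_mult_scaleR fun_eq_iff)

definition sufficiently_bounded ::
    "'a measure \<Rightarrow> ('a \<Rightarrow> 'a) \<Rightarrow> (nat \<Rightarrow> real) \<Rightarrow> ('a \<Rightarrow> int \<Rightarrow> real^'m^'m::finite) \<Rightarrow> bool" where
  "sufficiently_bounded M T V C \<longleftrightarrow>
     (AE x in M. AE v in proj_measure.
        (\<lambda>N. \<bar>log_growth C x v N - log_growth C (T x) (proj_act (C x 1) v) N\<bar> / V N) \<longlonglongrightarrow> 0)"

definition simple_dominated_splitting ::
    "'a measure \<Rightarrow> (nat \<Rightarrow> real) \<Rightarrow> ('a \<Rightarrow> int \<Rightarrow> real^'m^'m::finite) \<Rightarrow> bool" where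
  "simple_dominated_splitting M V C \<longleftrightarrow>
     (AE x in M. AE v in proj_measure. AE w in proj_measure.
        (\<lambda>N. \<bar>log_growth C x v N - log_growth C x w N\<bar> / V N) \<longlonglongrightarrow> 0)"

definition contracting :: "'a::metric_space measure \<Rightarrow> ('a \<Rightarrow> 'a) \<Rightarrow> ('a \<Rightarrow> 'a) \<Rightarrow> bool" where
  "contracting M T U \<longleftrightarrow>
     (AE x in M. (\<lambda>n. dist ((T ^^ n) (U x)) ((T ^^ n) x)) \<longlonglongrightarrow> 0)"

definition adapted ::
    "'a measure \<Rightarrow> ('a \<Rightarrow> 'a) \<Rightarrow> (nat \<Rightarrow> real) \<Rightarrow> ('a \<Rightarrow> int \<Rightarrow> real^'m^'m::finite) \<Rightarrow>
     ('a \<Rightarrow> nat \<Rightarrow> real^'m^'m) \<Rightarrow> bool" where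
  "adapted M U V C D \<longleftrightarrow>
     (AE x in M. AE v in proj_measure.
        (\<lambda>N. \<bar>log_growth C x v N - log_growth C (U x) (proj_act (D x 1) v) N\<bar> / V N) \<longlonglongrightarrow> 0)"

end

theory Submission
  imports Defs
begin

text \<open>
  For uniformly continuous \<open>g\<close>, the directional averages
  \<open>h N x = \<integral> g (S\<^sub>N N x v) d\<nu>(v)\<close> are asymptotically invariant under both \<open>T\<close> and \<open>U\<close>: a
  single direction can be compared with almost all others by domination, and moving from \<open>x\<close> to
  \<open>T x\<close> or \<open>U x\<close> costs only \<open>o(V N)\<close>. Since orbits of \<open>x\<close> and \<open>U x\<close> contract,
  \<open>h N \<cdot> 1\<^sub>B \<circ> T^N\<close> is asymptotically \<open>U\<close>-invariant, so ergodicity of \<open>U\<close> decorrelates it from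
  \<open>1\<^sub>A\<close>. Contraction also forces \<open>T\<close> to be ergodic, and asymptotic \<open>T\<close>-invariance of
  \<open>h N\<close> then decorrelates it from \<open>1\<^sub>B \<circ> T^N\<close>: replacing \<open>T^N\<close> by \<open>T^(N+j)\<close> is free for
  each fixed \<open>j\<close>, so \<open>1\<^sub>B\<close> may be replaced by its ergodic averages. Intervals are
  approximated by trapezoids whose slopes have non-atomic end points for \<open>S\<close>.
\<close>

section \<open>Ergodic averages and decorrelation\<close>

lemma measure_preservingD:
  assumes "measure_preserving M W"
  shows "W \<in> measurable M M" "distr M M W = M"
  using assms by (auto simp: measure_preserving_def)

lemma measure_preserving_integral:
  fixes f :: "'a \<Rightarrow> real"
  assumes "measure_preserving M W" and [measurable]: "f \<in> borel_measurable M"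
  shows "(\<integral>x. f (W x) \<partial>M) = (\<integral>x. f x \<partial>M)"
proof -
  note [measurable] = measure_preservingD(1)[OF assms(1)]
  have "(\<integral>x. f x \<partial>distr M M W) = (\<integral>x. f (W x) \<partial>M)"
    by (rule integral_distr) measurable
  then show ?thesis by (simp add: measure_preservingD(2)[OF assms(1)])
qed

lemma measure_preserving_AE:
  assumes "measure_preserving M W" and "AE x in M. Q x"
  shows "AE x in M. Q (W x)"
proof -
  have "AE x in distr M M W. Q x"
    by (subst measure_preservingD(2)[OF assms(1)]) (rule assms(2))
  from AE_distrD[OF measure_preservingD(1)[OF assms(1)] this] show ?thesis .
qed

lemma measure_preserving_id: "measure_preserving M (\<lambda>x. x)"
  by (simp add: measure_preserving_def distr_id)

lemma measure_preserving_funpow: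
  assumes "measure_preserving M W"
  shows "measure_preserving M (W ^^ n)"
proof (induction n)
  case 0
  then show ?case by (simp add: measure_preserving_def id_def distr_id)
next
  case (Suc n)
  note mp = measure_preservingD[OF assms] measure_preservingD[OF Suc]
  have "distr M M (W \<circ> (W ^^ n)) = distr (distr M M (W ^^ n)) M W"
    by (rule distr_distr[symmetric]) (use mp in auto)
  then show ?case
    using mp by (simp add: measure_preserving_def comp_def)
qed

context prob_space
begin

lemma integrable_bounded:
  fixes f :: "'a \<Rightarrow> real"
  assumes "f \<in> borel_measurable M" "\<And>x. \<bar>f x\<bar> \<le> B"
  shows "integrable M f"
  by (rule integrable_const_bound[where B = B]) (use assms in auto)

section \<open>The pointwise ergodic theorem for bounded functions\<close>

text \<open>A maximal-function argument. By ergodicity the partial sums are unbounded above either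
  almost nowhere or almost everywhere. In the latter case \<open>max (- m n (W x)) (g x)\<close>,
  whose integral is never negative, converges to \<open>g x\<close> and forces a nonnegative
  mean.\<close>

lemma ergodic_sums_bounded_above:
  fixes g :: "'a \<Rightarrow> real"
  assumes W: "measure_preserving M W" and erg: "ergodic M W"
    and g [measurable]: "g \<in> borel_measurable M"
    and B: "\<And>x. \<bar>g x\<bar> \<le> B" and neg: "(\<integral>x. g x \<partial>M) < 0"
  shows "AE x in M. \<exists>K. \<forall>n. (\<Sum>j<n. g ((W ^^ j) x)) \<le> K"
proof -
  note [measurable] = measure_preservingD(1)[OF W]
  \<comment> \<open>\<open>m n x\<close> is the largest of the partial sums of \<open>g\<close>
    along the \<open>W\<close>-orbit of \<open>x\<close> of lengths \<open>0\<close> to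
    \<open>n\<close>, built by splitting off the first term of the orbit.\<close>
  define m where "m n = ((\<lambda>f x. max 0 (g x + f (W x))) ^^ n) (\<lambda>_. 0)" for n
  have m0: "m 0 x = 0" and mS: "m (Suc n) x = max 0 (g x + m n (W x))" for n x
    by (simp_all add: m_def)
  have B0: "B \<ge> 0" using B abs_ge_zero order_trans by blast
  have mm [measurable]: "m n \<in> borel_measurable M" for n
  proof (induction n)
    case (Suc n)
    note [measurable] = Suc
    have "m (Suc n) = (\<lambda>x. max 0 (g x + m n (W x)))" by (simp add: mS fun_eq_iff)
    then show ?case by simp
  qed (simp add: m_def)
  have mpos: "m n x \<ge> 0" for n x by (cases n) (simp_all add: m0 mS)
  have mbd: "m n x \<le> real n * B" for n x
  proof (induction n arbitrary: x)
    case (Suc n)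
    have "g x + m n (W x) \<le> B + real n * B" using Suc[of "W x"] B[of x] by linarith
    moreover have "0 \<le> B + real n * B" using B0 by simp
    ultimately show ?case by (simp add: mS algebra_simps)
  qed (simp add: m0)
  have minc: "m n x \<le> m (Suc n) x" for n x
  proof (induction n arbitrary: x)
    case (Suc n)
    show ?case using Suc[of "W x"] by (subst (1 2) mS) simp
  qed (simp add: m0 mpos)
  then have mincs: "incseq (\<lambda>n. m n x)" for x by (simp add: incseq_SucI)
  have Sm: "(\<Sum>j<n. g ((W ^^ j) x)) \<le> m n x" for n x
  proof (induction n arbitrary: x)
    case (Suc n)
    have "(\<Sum>j<Suc n. g ((W ^^ j) x)) = g x + (\<Sum>j<n. g ((W ^^ j) (W x)))"
      by (subst sum.lessThan_Suc_shift) (simp add: funpow_swap1)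
    also have "\<dots> \<le> g x + m n (W x)" using Suc by simp
    finally show ?case by (simp add: mS)
  qed (simp add: m0)
  \<comment> \<open>Natural thresholds make \<open>E\<close> a countable combination of measurable
    sets; \<open>unb\<close> returns to real ones, which can be shifted.\<close>
  define E where "E = {x \<in> space M. \<forall>K::nat. \<exists>n. m n x > real K}"
  have E [measurable]: "E \<in> sets M" unfolding E_def by measurable
  have unb: "(\<forall>K::nat. \<exists>n. m n x > real K) \<longleftrightarrow> (\<forall>K::real. \<exists>n. m n x > K)" for x
    by (meson reals_Archimedean2 order_less_trans)
  \<comment> \<open>Passing between \<open>x\<close> and \<open>W x\<close> changes the threshold
    only by a bounded amount, so \<open>E\<close> is strictly invariant, as \<open>ergodic\<close>
    demands.\<close>
  have "(\<forall>K::real. \<exists>n. m n (W x) > K) \<longleftrightarrow> (\<forall>K::real. \<exists>n. m n x > K)" for x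
  proof safe
    fix K :: real assume "\<forall>K. \<exists>n. m n (W x) > K"
    then obtain n where "m n (W x) > K - g x" by blast
    then have "m (Suc n) x > K" by (simp add: mS)
    then show "\<exists>n. m n x > K" by blast
  next
    fix K :: real assume "\<forall>K. \<exists>n. m n x > K"
    \<comment> \<open>The maximum with \<open>0\<close> excludes \<open>n = 0\<close>, so a first
      term can be split off.\<close>
    then obtain n where n: "m n x > max 0 (K + B)" by blast
    then obtain k where "n = Suc k" by (cases n) (simp_all add: m0)
    with n have "g x + m k (W x) > K + B" by (simp add: mS max_def split: if_splits)
    with B[of x] have "m k (W x) > K" by linarith
    then show "\<exists>n. m n (W x) > K" by blast
  qed
  then have "W -` E \<inter> space M = E"
    using measurable_space[OF measure_preservingD(1)[OF W]] by (auto simp: E_def unb)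
  then have "prob E = 0 \<or> prob E = 1"
    using erg E by (auto simp: ergodic_def prob_space)
  moreover have "prob E \<noteq> 1"
  proof
    assume "prob E = 1"
    then have AE: "AE x in M. x \<in> E" by (simp add: prob_eq_1)
    \<comment> \<open>Where \<open>W x\<close> lies in \<open>E\<close>, the increasing sequence
      \<open>m n (W x)\<close> eventually exceeds \<open>B\<close>, and from then on the maximum is
      \<open>g x\<close>.\<close>
    have lim: "(\<lambda>n. \<integral>x. max (- m n (W x)) (g x) \<partial>M) \<longlonglongrightarrow> (\<integral>x. g x \<partial>M)"
    proof (rule integral_dominated_convergence[where w = "\<lambda>_. B"])
      show "AE x in M. (\<lambda>n. max (- m n (W x)) (g x)) \<longlonglongrightarrow> g x"
        using measure_preserving_AE[OF W AE]
      proof eventually_elim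
        fix x assume "W x \<in> E"
        then obtain k where k: "m k (W x) > B" by (auto simp: E_def unb)
        have "max (- m n (W x)) (g x) = g x" if "n \<ge> k" for n
          using incseqD[OF mincs[of "W x"] that] k B[of x] by linarith
        then show "(\<lambda>n. max (- m n (W x)) (g x)) \<longlonglongrightarrow> g x"
          by (intro tendsto_eventually) (auto simp: eventually_sequentially)
      qed
      show "AE x in M. norm (max (- m n (W x)) (g x)) \<le> B" for n
      proof (rule AE_I2)
        fix x show "norm (max (- m n (W x)) (g x)) \<le> B" using mpos[of n "W x"] B[of x]
          by (simp add: max_def abs_le_iff)
      qed
    qed auto
    have int: "integrable M (m n)" for n
      by (rule integrable_bounded[where B = "real n * B"]) (use mpos mbd in auto)
    have intW: "integrable M (\<lambda>x. m n (W x))" for n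
      by (rule integrable_bounded[where B = "real n * B"]) (use mpos mbd in auto)
    have "(\<integral>x. max (- m n (W x)) (g x) \<partial>M) \<ge> 0" for n
    proof -
      \<comment> \<open>By the recursion the integrand is \<open>m (Suc n) x - m n (W x)\<close>;
        invariance of the measure and monotonicity in \<open>n\<close> then give the sign.\<close>
      have "(\<integral>x. max (- m n (W x)) (g x) \<partial>M) = (\<integral>x. m (Suc n) x - m n (W x) \<partial>M)"
        by (rule Bochner_Integration.integral_cong) (auto simp: mS max_def)
      also have "\<dots> = (\<integral>x. m (Suc n) x \<partial>M) - (\<integral>x. m n x \<partial>M)"
        by (simp add: int intW measure_preserving_integral[OF W])
      finally show ?thesis
        using integral_mono[OF int int, of n "Suc n"] minc by simp
    qed
    then have "(\<integral>x. g x \<partial>M) \<ge> 0" by (intro LIMSEQ_le_const[OF lim]) auto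
    with neg show False by simp
  qed
  ultimately have "prob E = 0" by simp
  then have "AE x in M. x \<notin> E" by (simp add: prob_eq_0)
  with AE_space show ?thesis
  proof eventually_elim
    fix x assume "x \<in> space M" "x \<notin> E"
    then obtain K where "\<And>n. m n x \<le> real K" by (auto simp: E_def not_less)
    with Sm[of x] have "\<forall>n. (\<Sum>j<n. g ((W ^^ j) x)) \<le> real K" by (meson order_trans)
    then show "\<exists>K. \<forall>n. (\<Sum>j<n. g ((W ^^ j) x)) \<le> K" by blast
  qed
qed


text \<open>By \<open>ergodic_sums_bounded_above\<close>, the sums of \<open>f\<close> minus a
  constant slightly above its mean are bounded above, and the same holds for \<open>- f\<close>.
  Dividing by \<open>n\<close> squeezes the averages to within an arbitrarily small slack of the
  mean.\<close>

lemma ergodic_average_tendsto: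
  fixes f :: "'a \<Rightarrow> real"
  assumes W: "measure_preserving M W" and erg: "ergodic M W"
    and f [measurable]: "f \<in> borel_measurable M" and B: "\<And>x. \<bar>f x\<bar> \<le> B"
  shows "AE x in M. (\<lambda>n. (\<Sum>j<n. f ((W ^^ j) x)) / n) \<longlonglongrightarrow> (\<integral>x. f x \<partial>M)"
proof -
  have up: "AE x in M. \<exists>K. \<forall>n. (\<Sum>j<n. h ((W ^^ j) x)) \<le> K + n * ((\<integral>x. h x \<partial>M) + 1 / Suc k)"
    if h [measurable]: "h \<in> borel_measurable M" and Bh: "\<And>x. \<bar>h x\<bar> \<le> B"
    for h :: "'a \<Rightarrow> real" and k
  proof -
    \<comment> \<open>The slack \<open>1 / Suc k\<close> makes the mean of \<open>h - c\<close>
      strictly negative. Countably many slacks suffice, so the exceptional sets can be united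
      later.\<close>
    define c where "c = (\<integral>x. h x \<partial>M) + 1 / Suc k"
    have "integrable M h" using h Bh by (rule integrable_bounded)
    then have "(\<integral>x. h x - c \<partial>M) < 0" by (simp add: c_def prob_space)
    moreover have "\<bar>h x - c\<bar> \<le> B + \<bar>c\<bar>" for x using Bh[of x] by linarith
    ultimately have "AE x in M. \<exists>K. \<forall>n. (\<Sum>j<n. h ((W ^^ j) x) - c) \<le> K"
      by (intro ergodic_sums_bounded_above[OF W erg]) auto
    then show ?thesis
      by (simp add: sum_subtractf c_def algebra_simps)
  qed
  have "integrable M f" using f B by (rule integrable_bounded)
  then have neg: "(\<integral>x. - f x \<partial>M) = - (\<integral>x. f x \<partial>M)" by simp
  have "AE x in M. \<forall>k. \<exists>K. \<forall>n. (\<Sum>j<n. f ((W ^^ j) x)) \<le> K + n * ((\<integral>x. f x \<partial>M) + 1 / Suc k)"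
    using up[OF f B] by (simp add: AE_all_countable)
  moreover have "AE x in M. \<forall>k. \<exists>K. \<forall>n. - (\<Sum>j<n. f ((W ^^ j) x)) \<le> K + n * (- (\<integral>x. f x \<partial>M) + 1 / Suc k)"
    using up[of "\<lambda>x. - f x"] B by (simp add: AE_all_countable neg sum_negf)
  ultimately show ?thesis
  proof eventually_elim
    fix x
    define s where "s n = (\<Sum>j<n. f ((W ^^ j) x))" for n
    define c where "c = (\<integral>x. f x \<partial>M)"
    assume "\<forall>k. \<exists>K. \<forall>n. (\<Sum>j<n. f ((W ^^ j) x)) \<le> K + n * ((\<integral>x. f x \<partial>M) + 1 / Suc k)"
      and "\<forall>k. \<exists>K. \<forall>n. - (\<Sum>j<n. f ((W ^^ j) x)) \<le> K + n * (- (\<integral>x. f x \<partial>M) + 1 / Suc k)"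
    then have u: "\<And>k. \<exists>K. \<forall>n. s n \<le> K + n * (c + 1 / Suc k)"
      and l: "\<And>k. \<exists>K. \<forall>n. - s n \<le> K + n * (- c + 1 / Suc k)"
      by (simp_all add: s_def c_def)
    have "(\<lambda>n. s n / n) \<longlonglongrightarrow> c"
    proof (rule LIMSEQ_I)
      fix e :: real assume "e > 0"
      then obtain k where k: "1 / Suc k < e / 2"
        using reals_Archimedean[of "e / 2"] by (auto simp: inverse_eq_divide)
      obtain K1 where K1: "\<And>n. s n \<le> K1 + n * (c + 1 / Suc k)" using u by blast
      obtain K2 where K2: "\<And>n. - s n \<le> K2 + n * (- c + 1 / Suc k)" using l by blast
      \<comment> \<open>Beyond \<open>n0\<close> the orbit-dependent constants \<open>K1\<close> and
        \<open>K2\<close> cost less than \<open>n * (e / 2)\<close>; the slack accounts for the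
        other half.\<close>
      obtain n0 :: nat where n0: "real n0 > 2 * (\<bar>K1\<bar> + \<bar>K2\<bar>) / e" using reals_Archimedean2 by blast
      have "norm (s n / n - c) < e" if n: "n \<ge> Suc n0" for n
      proof -
        have npos: "real n > 0" using n by simp
        have "2 * (\<bar>K1\<bar> + \<bar>K2\<bar>) / e < n" using n0 n by linarith
        then have big: "\<bar>K1\<bar> + \<bar>K2\<bar> < n * (e / 2)" using \<open>e > 0\<close> by (simp add: field_simps)
        have small: "n * (1 / Suc k) < n * (e / 2)" using k npos by (intro mult_strict_left_mono)
        have a: "n * (c + 1 / Suc k) = n * c + n * (1 / Suc k)"
          "n * (- c + 1 / Suc k) = - (n * c) + n * (1 / Suc k)" by (simp_all add: algebra_simps)
        have "\<bar>s n - n * c\<bar> < n * e"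
          using K1[of n] K2[of n] big small unfolding a abs_less_iff by linarith
        then have "\<bar>s n - n * c\<bar> / n < e" using npos by (simp add: field_simps)
        moreover have "\<bar>s n - n * c\<bar> / n = \<bar>s n / n - c\<bar>"
        proof -
          have "(s n - n * c) / n = s n / n - c" using npos by (simp add: diff_divide_distrib)
          then show ?thesis using npos by (metis abs_divide abs_of_pos)
        qed
        ultimately show ?thesis by simp
      qed
      then show "\<exists>no. \<forall>n\<ge>no. norm (s n / n - c) < e" by blast
    qed
    then show "(\<lambda>n. (\<Sum>j<n. f ((W ^^ j) x)) / n) \<longlonglongrightarrow> (\<integral>x. f x \<partial>M)"
      by (simp add: s_def c_def)
  qed
qed

lemma ergodic_average_tendsto_L1:
  fixes f :: "'a \<Rightarrow> real"
  assumes W: "measure_preserving M W" and erg: "ergodic M W"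
    and f [measurable]: "f \<in> borel_measurable M" and B: "\<And>x. \<bar>f x\<bar> \<le> B"
  shows "(\<lambda>n. \<integral>x. \<bar>(\<Sum>j<n. f ((W ^^ j) x)) / n - (\<integral>x. f x \<partial>M)\<bar> \<partial>M) \<longlonglongrightarrow> 0"
proof -
  define c where "c = (\<integral>x. f x \<partial>M)"
  have [measurable]: "W ^^ j \<in> measurable M M" for j
    by (rule measure_preservingD(1)[OF measure_preserving_funpow[OF W]])
  have B0: "B \<ge> 0" using B abs_ge_zero order_trans by blast
  have "(\<lambda>n. \<integral>x. \<bar>(\<Sum>j<n. f ((W ^^ j) x)) / n - c\<bar> \<partial>M) \<longlonglongrightarrow> (\<integral>x. 0 \<partial>M)"
  proof (rule integral_dominated_convergence[where w = "\<lambda>_. B + \<bar>c\<bar>"])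
    show "AE x in M. (\<lambda>n. \<bar>(\<Sum>j<n. f ((W ^^ j) x)) / n - c\<bar>) \<longlonglongrightarrow> 0"
      using ergodic_average_tendsto[OF assms]
      by eventually_elim (simp add: tendsto_rabs_zero_iff LIM_zero c_def)
    show "AE x in M. norm \<bar>(\<Sum>j<n. f ((W ^^ j) x)) / n - c\<bar> \<le> B + \<bar>c\<bar>" for n
    proof (rule AE_I2)
      fix x
      have "\<bar>\<Sum>j<n. f ((W ^^ j) x)\<bar> \<le> (\<Sum>j<n. B)"
        by (rule order_trans[OF sum_abs]) (intro sum_mono B)
      \<comment> \<open>For \<open>n = 0\<close> the quotient is \<open>0\<close>, and the bound is
        then \<open>B0\<close>.\<close>
      then have "\<bar>(\<Sum>j<n. f ((W ^^ j) x)) / n\<bar> \<le> B"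
        using B0 by (cases "n = 0") (simp_all add: field_simps)
      then show "norm \<bar>(\<Sum>j<n. f ((W ^^ j) x)) / n - c\<bar> \<le> B + \<bar>c\<bar>"
        unfolding real_norm_def by linarith
    qed
  qed auto
  then show ?thesis by (simp add: c_def)
qed

section \<open>Decorrelation of asymptotically invariant sequences\<close>

text \<open>Precomposing \<open>f\<close> with a fixed power of \<open>W\<close> is asymptotically
  free, because \<open>k N\<close> is nearly \<open>W\<close>-invariant and \<open>R N\<close>
  commutes with \<open>W\<close>. Averaging over the first \<open>n\<close> powers replaces
  \<open>f\<close> by ergodic averages, which are close in L1 to the constant mean. The family
  \<open>R\<close> allows both the identity and the powers \<open>T ^^ N\<close>.\<close>

lemma asymptotically_invariant_decorrelates:
  fixes f :: "'a \<Rightarrow> real" and k :: "nat \<Rightarrow> 'a \<Rightarrow> real"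
  assumes W: "measure_preserving M W" and erg: "ergodic M W"
    and k [measurable]: "\<And>N. k N \<in> borel_measurable M" and k1: "\<And>N x. \<bar>k N x\<bar> \<le> 1"
    and inv: "(\<lambda>N. \<integral>x. \<bar>k N (W x) - k N x\<bar> \<partial>M) \<longlonglongrightarrow> 0"
    and R: "\<And>N. measure_preserving M (R N)" and comm: "\<And>N x. R N (W x) = W (R N x)"
    and f [measurable]: "f \<in> borel_measurable M" and f1: "\<And>x. \<bar>f x\<bar> \<le> 1"
  shows "(\<lambda>N. (\<integral>x. k N x * f (R N x) \<partial>M) - (\<integral>x. k N x \<partial>M) * (\<integral>x. f x \<partial>M)) \<longlonglongrightarrow> 0"
proof -
  define c where "c = (\<integral>x. f x \<partial>M)"
  have [measurable]: "W \<in> measurable M M" "R N \<in> measurable M M" "W ^^ j \<in> measurable M M" for N j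
    using measure_preservingD(1) W R measure_preserving_funpow[OF W] by blast+
  define I where "I j N = (\<integral>x. k N x * f ((W ^^ j) (R N x)) \<partial>M)" for j N
  have bd: "\<bar>a * b\<bar> \<le> 1" if "\<bar>a\<bar> \<le> 1" "\<bar>b\<bar> \<le> 1" for a b :: real
    using mult_mono[OF that] by (simp add: abs_mult)
  have intI: "integrable M (\<lambda>x. k N x * f ((W ^^ j) (R N x)))" for j N
    by (rule integrable_bounded[where B = 1]) (auto intro!: bd k1 f1)
  have step: "\<bar>I j N - I (Suc j) N\<bar> \<le> (\<integral>x. \<bar>k N (W x) - k N x\<bar> \<partial>M)" for j N
  proof -
    have int': "integrable M (\<lambda>x. k N (W x) * f ((W ^^ Suc j) (R N x)))"
      by (rule integrable_bounded[where B = 1]) (auto intro!: bd k1 f1)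
    \<comment> \<open>Substituting \<open>W x\<close> for \<open>x\<close> moves one
      \<open>W\<close> through \<open>R N\<close> and raises the exponent, while \<open>k N\<close>
      is now evaluated at \<open>W x\<close>.\<close>
    have "I j N = (\<integral>x. k N (W x) * f ((W ^^ Suc j) (R N x)) \<partial>M)"
      unfolding I_def
      by (subst measure_preserving_integral[OF W, symmetric]) (auto simp: comm funpow_swap1)
    moreover have "(\<integral>x. (k N (W x) - k N x) * f ((W ^^ Suc j) (R N x)) \<partial>M)
        = (\<integral>x. k N (W x) * f ((W ^^ Suc j) (R N x)) \<partial>M) - I (Suc j) N"
      using int' intI[of N "Suc j"] unfolding I_def left_diff_distrib by (rule Bochner_Integration.integral_diff)
    ultimately have "I j N - I (Suc j) N = (\<integral>x. (k N (W x) - k N x) * f ((W ^^ Suc j) (R N x)) \<partial>M)"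
      by simp
    also have "\<bar>\<dots>\<bar> \<le> (\<integral>x. \<bar>(k N (W x) - k N x) * f ((W ^^ Suc j) (R N x))\<bar> \<partial>M)"
      by (rule integral_abs_bound)
    also have "\<dots> \<le> (\<integral>x. \<bar>k N (W x) - k N x\<bar> \<partial>M)"
    proof (rule integral_mono)
      have b2: "\<bar>k N (W x) - k N x\<bar> \<le> 2" for x
        using k1[of N x] k1[of N "W x"] by linarith
      show le: "\<bar>(k N (W x) - k N x) * f ((W ^^ Suc j) (R N x))\<bar> \<le> \<bar>k N (W x) - k N x\<bar>" for x
        by (simp add: abs_mult mult_left_le f1 del: funpow.simps)
      show "integrable M (\<lambda>x. \<bar>k N (W x) - k N x\<bar>)"
        by (rule integrable_bounded[where B = 2]) (use b2 in auto)
      show "integrable M (\<lambda>x. \<bar>(k N (W x) - k N x) * f ((W ^^ Suc j) (R N x))\<bar>)"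
        by (rule integrable_bounded[where B = 2]) (measurable, simp only: abs_abs order_trans[OF le b2])
    qed
    finally show ?thesis .
  qed
  have shift: "(\<lambda>N. I j N - I 0 N) \<longlonglongrightarrow> 0" for j
  proof (induction j)
    case (Suc j)
    have "(\<lambda>N. I j N - I (Suc j) N) \<longlonglongrightarrow> 0"
      using inv by (rule Lim_null_comparison[rotated]) (simp add: step)
    from tendsto_diff[OF Suc this] show ?case by simp
  qed simp
  show ?thesis
  proof (rule LIMSEQ_I)
    fix e :: real assume "e > 0"
    \<comment> \<open>The length \<open>n\<close> is fixed before \<open>N\<close> tends to
      infinity, since \<open>shift\<close> controls one exponent \<open>j\<close> at a time.\<close>
    have "eventually (\<lambda>n. \<bar>\<integral>x. \<bar>(\<Sum>j<n. f ((W ^^ j) x)) / n - c\<bar> \<partial>M\<bar> < e / 2) sequentially"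
      using order_tendstoD(2)[OF tendsto_rabs_zero[OF ergodic_average_tendsto_L1[OF W erg f f1]], of "e / 2"]
        \<open>e > 0\<close> by (simp add: c_def)
    from eventually_happens'[OF sequentially_bot eventually_conj[OF eventually_gt_at_top[of 0] this]]
    obtain n :: nat where n: "n > 0"
      and ne: "\<bar>\<integral>x. \<bar>(\<Sum>j<n. f ((W ^^ j) x)) / n - c\<bar> \<partial>M\<bar> < e / 2"
      by blast
    define a where "a x = (\<Sum>j<n. f ((W ^^ j) x)) / n" for x
    have [measurable]: "a \<in> borel_measurable M" unfolding a_def by measurable
    have a1: "\<bar>a x\<bar> \<le> 1" for x
    proof -
      have "\<bar>\<Sum>j<n. f ((W ^^ j) x)\<bar> \<le> (\<Sum>j<n. 1)"
        by (rule order_trans[OF sum_abs]) (intro sum_mono f1)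
      then show ?thesis using n by (simp add: a_def)
    qed
    have inta: "integrable M (\<lambda>x. k N x * a (R N x))" for N
      by (rule integrable_bounded[where B = 1]) (auto intro!: bd k1 a1)
    have intk: "integrable M (k N)" for N
      by (rule integrable_bounded[where B = 1]) (auto intro!: k1)
    have "(\<lambda>N. (\<Sum>j<n. I j N - I 0 N) / n) \<longlonglongrightarrow> (\<Sum>j<n. 0) / n"
      by (intro tendsto_intros shift) (use n in auto)
    moreover have "(\<Sum>j<n. I j N - I 0 N) / n = (\<integral>x. k N x * a (R N x) \<partial>M) - I 0 N" for N
    proof -
      have "(\<integral>x. k N x * a (R N x) \<partial>M) = (\<integral>x. (\<Sum>j<n. k N x * f ((W ^^ j) (R N x))) / n \<partial>M)"
        by (simp add: a_def sum_distrib_left)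
      also have "\<dots> = (\<Sum>j<n. I j N) / n"
        unfolding I_def by (simp add: intI)
      finally show ?thesis using n by (simp add: sum_subtractf diff_divide_distrib)
    qed
    ultimately have "(\<lambda>N. (\<integral>x. k N x * a (R N x) \<partial>M) - I 0 N) \<longlonglongrightarrow> 0" by simp
    from LIMSEQ_D[OF this, of "e / 2"] \<open>e > 0\<close> obtain N0 where
      N0: "\<And>N. N \<ge> N0 \<Longrightarrow> \<bar>(\<integral>x. k N x * a (R N x) \<partial>M) - I 0 N\<bar> < e / 2" by auto
    \<comment> \<open>This estimate is uniform in \<open>N\<close>, since \<open>R N\<close>
      preserves the measure and \<open>k N\<close> is bounded by \<open>1\<close>.\<close>
    have A: "\<bar>(\<integral>x. k N x * a (R N x) \<partial>M) - (\<integral>x. k N x \<partial>M) * c\<bar> < e / 2" for N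
    proof -
      have "(\<integral>x. k N x * a (R N x) \<partial>M) - (\<integral>x. k N x \<partial>M) * c = (\<integral>x. k N x * (a (R N x) - c) \<partial>M)"
        using inta intk by (simp add: right_diff_distrib)
      also have "\<bar>\<dots>\<bar> \<le> (\<integral>x. \<bar>k N x * (a (R N x) - c)\<bar> \<partial>M)"
        by (rule integral_abs_bound)
      also have "\<dots> \<le> (\<integral>x. \<bar>a (R N x) - c\<bar> \<partial>M)"
      proof (rule integral_mono)
        have b2: "\<bar>a x - c\<bar> \<le> 1 + \<bar>c\<bar>" for x
          using a1[of x] by linarith
        show le: "\<bar>k N x * (a (R N x) - c)\<bar> \<le> \<bar>a (R N x) - c\<bar>" for x
          by (simp add: abs_mult mult_left_le_one_le k1)
        show "integrable M (\<lambda>x. \<bar>a (R N x) - c\<bar>)"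
          by (rule integrable_bounded[where B = "1 + \<bar>c\<bar>"]) (use b2 in auto)
        show "integrable M (\<lambda>x. \<bar>k N x * (a (R N x) - c)\<bar>)"
          by (rule integrable_bounded[where B = "1 + \<bar>c\<bar>"]) (measurable, simp only: abs_abs order_trans[OF le b2])
      qed
      also have "\<dots> = (\<integral>x. \<bar>a x - c\<bar> \<partial>M)"
        by (subst measure_preserving_integral[OF R, of "\<lambda>x. \<bar>a x - c\<bar>"]) auto
      finally show ?thesis using ne by (simp add: a_def)
    qed
    have "norm ((\<integral>x. k N x * f (R N x) \<partial>M) - (\<integral>x. k N x \<partial>M) * c - 0) < e" if "N \<ge> N0" for N
      using N0[OF that] A[of N] unfolding I_def real_norm_def funpow_0 by linarith
    then show "\<exists>no. \<forall>N\<ge>no. norm ((\<integral>x. k N x * f (R N x) \<partial>M) - (\<integral>x. k N x \<partial>M) * (\<integral>x. f x \<partial>M) - 0) < e"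
      unfolding c_def by blast
  qed
qed

end

section \<open>Contracting pairs\<close>

text \<open>For bounded Lipschitz functions the claim is dominated convergence from
  \<open>contracting\<close>. L1 approximation extends it to closed sets. The sets satisfying it are
  stable under complements and disjoint countable unions, so Dynkin's argument over the
  intersection-stable closed sets reaches all Borel sets.\<close>

lemma contracting_indicator_L1:
  fixes M :: "'a::metric_space measure"
  assumes "prob_space M" and sets: "sets M = sets borel"
    and T: "measure_preserving M T" and U: "measure_preserving M U"
    and contr: "contracting M T U" and B: "B \<in> sets borel"
  shows "(\<lambda>n. \<integral>x. \<bar>indicator B ((T ^^ n) (U x)) - indicator B ((T ^^ n) x) :: real\<bar> \<partial>M) \<longlonglongrightarrow> 0"
proof -
  interpret prob_space M by fact
  note sets [measurable_cong]
  have Tn: "measure_preserving M (T ^^ n)" for n by (rule measure_preserving_funpow[OF T])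
  note [measurable] = measure_preservingD(1)[OF U] measure_preservingD(1)[OF Tn]
  define d where "d f n = (\<integral>x. \<bar>f ((T ^^ n) (U x)) - f ((T ^^ n) x) :: real\<bar> \<partial>M)" for f n
  \<comment> \<open>Both \<open>T ^^ n\<close> and its composition with \<open>U\<close> preserve
    the measure, so replacing \<open>f\<close> by \<open>p k\<close> costs twice their L1 distance
    for every \<open>n\<close> at once.\<close>
  have d_approx: "d f \<longlonglongrightarrow> 0"
    if f [measurable]: "f \<in> borel_measurable M" and f1: "\<And>x. \<bar>f x\<bar> \<le> 1"
      and p [measurable]: "\<And>k. p k \<in> borel_measurable M" and p1: "\<And>k x. \<bar>p k x\<bar> \<le> 1"
      and lim: "\<And>x. (\<lambda>k. p k x) \<longlonglongrightarrow> f x" and dp: "\<And>k. d (p k) \<longlonglongrightarrow> 0"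
    for f and p :: "nat \<Rightarrow> 'a \<Rightarrow> real"
  proof (rule LIMSEQ_I)
    fix e :: real assume e: "e > 0"
    have diff2: "\<bar>f x - p k x\<bar> \<le> 2" for k x using f1[of x] p1[of k x] by linarith
    have "(\<lambda>k. \<integral>x. \<bar>f x - p k x\<bar> \<partial>M) \<longlonglongrightarrow> (\<integral>x. 0 \<partial>M)"
    proof (rule integral_dominated_convergence[where w = "\<lambda>_. 2"])
      show "AE x in M. (\<lambda>k. \<bar>f x - p k x\<bar>) \<longlonglongrightarrow> 0"
      proof (rule AE_I2)
        fix x
        show "(\<lambda>k. \<bar>f x - p k x\<bar>) \<longlonglongrightarrow> 0"
          using tendsto_rabs[OF tendsto_diff[OF tendsto_const lim], of "f x" x] by simp
      qed
    qed (use diff2 in auto)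
    from LIMSEQ_D[OF this, of "e / 4"] e obtain k where k: "(\<integral>x. \<bar>f x - p k x\<bar> \<partial>M) < e / 4"
      by (auto simp: abs_less_iff)
    from order_tendstoD(2)[OF dp[of k], of "e / 2"] e obtain n0 where n0: "\<And>n. n \<ge> n0 \<Longrightarrow> d (p k) n < e / 2"
      by (auto simp: eventually_sequentially)
    have "norm (d f n - 0) < e" if "n \<ge> n0" for n
    proof -
      have i1: "integrable M (\<lambda>x. \<bar>f ((T ^^ n) (U x)) - p k ((T ^^ n) (U x))\<bar>)"
        and i2: "integrable M (\<lambda>x. \<bar>f ((T ^^ n) x) - p k ((T ^^ n) x)\<bar>)"
        by (rule integrable_bounded[where B = 2]; use diff2 in simp)+
      have bb: "\<bar>a - b\<bar> \<le> 2" if "\<bar>a\<bar> \<le> 1" "\<bar>b\<bar> \<le> 1" for a b :: real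
        using that by linarith
      have i3: "integrable M (\<lambda>x. \<bar>p k ((T ^^ n) (U x)) - p k ((T ^^ n) x)\<bar>)"
        and i4: "integrable M (\<lambda>x. \<bar>f ((T ^^ n) (U x)) - f ((T ^^ n) x)\<bar>)"
        by (rule integrable_bounded[where B = 2]; use f1 p1 bb in simp)+
      have "d f n \<le> (\<integral>x. \<bar>f ((T ^^ n) (U x)) - p k ((T ^^ n) (U x))\<bar> + \<bar>f ((T ^^ n) x) - p k ((T ^^ n) x)\<bar>
          + \<bar>p k ((T ^^ n) (U x)) - p k ((T ^^ n) x)\<bar> \<partial>M)"
        unfolding d_def by (rule integral_mono) (use i1 i2 i3 i4 in auto)
      also have "\<dots> = (\<integral>x. \<bar>f ((T ^^ n) (U x)) - p k ((T ^^ n) (U x))\<bar> \<partial>M)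
          + (\<integral>x. \<bar>f ((T ^^ n) x) - p k ((T ^^ n) x)\<bar> \<partial>M) + d (p k) n"
        unfolding d_def using i1 i2 i3 by simp
      also have "(\<integral>x. \<bar>f ((T ^^ n) (U x)) - p k ((T ^^ n) (U x))\<bar> \<partial>M)
          = (\<integral>x. \<bar>f ((T ^^ n) x) - p k ((T ^^ n) x)\<bar> \<partial>M)"
        by (subst measure_preserving_integral[OF U, of "\<lambda>x. \<bar>f ((T ^^ n) x) - p k ((T ^^ n) x)\<bar>"]) auto
      also have "(\<integral>x. \<bar>f ((T ^^ n) x) - p k ((T ^^ n) x)\<bar> \<partial>M) = (\<integral>x. \<bar>f x - p k x\<bar> \<partial>M)"
        by (subst measure_preserving_integral[OF Tn, of "\<lambda>x. \<bar>f x - p k x\<bar>"]) auto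
      finally have "d f n < e" using k n0[OF that] by linarith
      moreover have "d f n \<ge> 0" by (simp add: d_def)
      ultimately show ?thesis by simp
    qed
    then show "\<exists>no. \<forall>n\<ge>no. norm (d f n - 0) < e" by blast
  qed
  have "Int_stable (Collect closed :: 'a set set)" by (auto simp: Int_stable_def)
  moreover have "Collect closed \<subseteq> Pow (UNIV :: 'a set)" by simp
  moreover have "B \<in> sigma_sets UNIV (Collect closed)" using B by (simp add: borel_eq_closed)
  ultimately have "d (indicator B) \<longlonglongrightarrow> 0"
  proof (induction rule: sigma_sets_induct_disjoint)
    case (basic A)
    then have A: "closed A" by simp
    \<comment> \<open>\<open>infdist\<close> to the empty set is \<open>0\<close>, so the bumps
      below would not converge to its indicator.\<close>
    show ?case
    proof (cases "A = {}")
      case True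
      then show ?thesis by (simp add: d_def indicator_def)
    next
      case False
      \<comment> \<open>Bumps of Lipschitz constant \<open>k\<close> that decrease to the indicator
        of \<open>A\<close> because \<open>A\<close> is closed.\<close>
      define p where "p k x = max 0 (1 - real k * infdist x A)" for k x
      have p0: "0 \<le> p k x" and p1: "p k x \<le> 1" for k x
        by (simp_all add: p_def infdist_nonneg)
      have pm [measurable]: "p k \<in> borel_measurable M" for k
      proof -
        have "p k \<in> borel_measurable borel"
          unfolding p_def by (intro borel_measurable_continuous_onI continuous_intros)
        then show ?thesis by simp
      qed
      have plip: "\<bar>p k x - p k y\<bar> \<le> k * dist x y" for k x y
      proof -
        have "\<bar>p k x - p k y\<bar> \<le> \<bar>real k * infdist x A - real k * infdist y A\<bar>"
          unfolding p_def by linarith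
        also have "\<dots> = k * \<bar>infdist x A - infdist y A\<bar>"
          by (simp add: right_diff_distrib[symmetric] abs_mult)
        also have "\<dots> \<le> k * dist x y" by (intro mult_left_mono infdist_triangle_abs) simp
        finally show ?thesis .
      qed
      show ?thesis
      proof (rule d_approx[of "indicator A" p])
        show "(\<lambda>k. p k x) \<longlonglongrightarrow> indicator A x" for x
        proof (cases "x \<in> A")
          case False
          then have pos: "infdist x A > 0"
            using A \<open>A \<noteq> {}\<close> by (metis in_closed_iff_infdist_zero infdist_nonneg less_eq_real_def)
          then obtain k0 :: nat where k0: "k0 * infdist x A > 1" using reals_Archimedean3 by blast
          have "p k x = 0" if "k \<ge> k0" for k
          proof -
            have "real k0 * infdist x A \<le> real k * infdist x A"
              using that pos by (intro mult_right_mono) auto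
            then show ?thesis using k0 by (simp add: p_def)
          qed
          then have "eventually (\<lambda>k. p k x = indicator A x) sequentially"
            using False by (auto simp: eventually_sequentially)
          then show ?thesis by (rule tendsto_eventually)
        qed (simp add: p_def)
        show "d (p k) \<longlonglongrightarrow> 0" for k
        proof -
          have "d (p k) \<longlonglongrightarrow> (\<integral>x. 0 \<partial>M)"
            unfolding d_def
          proof (rule integral_dominated_convergence[where w = "\<lambda>_. 1"])
            show "AE x in M. (\<lambda>n. \<bar>p k ((T ^^ n) (U x)) - p k ((T ^^ n) x)\<bar>) \<longlonglongrightarrow> 0"
              using contr unfolding contracting_def
            proof eventually_elim
              fix x assume "(\<lambda>n. dist ((T ^^ n) (U x)) ((T ^^ n) x)) \<longlonglongrightarrow> 0"
              then have "(\<lambda>n. k * dist ((T ^^ n) (U x)) ((T ^^ n) x)) \<longlonglongrightarrow> 0"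
                by (rule tendsto_mult_right_zero)
              then show "(\<lambda>n. \<bar>p k ((T ^^ n) (U x)) - p k ((T ^^ n) x)\<bar>) \<longlonglongrightarrow> 0"
                by (rule Lim_null_comparison[rotated]) (simp add: plip)
            qed
            show "AE x in M. norm \<bar>p k ((T ^^ n) (U x)) - p k ((T ^^ n) x)\<bar> \<le> 1" for n
            proof (rule AE_I2)
              fix x show "norm \<bar>p k ((T ^^ n) (U x)) - p k ((T ^^ n) x)\<bar> \<le> 1"
                using p0[of k "(T ^^ n) (U x)"] p1[of k "(T ^^ n) (U x)"] p0[of k "(T ^^ n) x"] p1[of k "(T ^^ n) x"]
                by (simp add: abs_le_iff)
            qed
          qed auto
          then show ?thesis by simp
        qed
        show "indicator A \<in> borel_measurable M" 
          by (intro borel_measurable_indicator) (simp add: sets borel_closed A)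
      qed (use p0 p1 in \<open>auto simp: indicator_def\<close>)
    qed
  next
    case empty
    then show ?case by (simp add: d_def)
  next
    case (compl A)
    have "d (indicator (UNIV - A)) n = d (indicator A) n" for n
      unfolding d_def by (rule Bochner_Integration.integral_cong) (auto simp: indicator_def)
    with compl show ?case by (simp add: fun_eq_iff)
  next
    case (union A)
    then have [measurable]: "A i \<in> sets M" for i by (auto simp: sets borel_eq_closed)
    \<comment> \<open>Disjointness turns the indicator of a finite union into a sum, so
      \<open>d\<close> is subadditive there; \<open>d_approx\<close> handles the passage to the
      infinite union.\<close>
    have sum: "indicator (\<Union>i<k. A i) x = (\<Sum>i<k. indicator (A i) x :: real)" for k x
      using union(1) by (intro indicator_UN_disjoint) (auto simp: disjoint_family_on_def)
    show ?case
    proof (rule d_approx[of "indicator (\<Union>i. A i)" "\<lambda>k. indicator (\<Union>i<k. A i)"])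
      show "(\<lambda>k. indicator (\<Union>i<k. A i) x) \<longlonglongrightarrow> (indicator (\<Union>i. A i) x :: real)" for x
        by (rule LIMSEQ_indicator_UN)
      show "d (indicator (\<Union>i<k. A i)) \<longlonglongrightarrow> 0" for k
      proof (rule Lim_null_comparison)
        show "(\<lambda>n. \<Sum>i<k. d (indicator (A i)) n) \<longlonglongrightarrow> 0"
          using union(3) by (intro tendsto_null_sum) auto
        show "\<forall>\<^sub>F n in sequentially. norm (d (indicator (\<Union>i<k. A i)) n) \<le> (\<Sum>i<k. d (indicator (A i)) n)"
        proof (intro always_eventually allI)
          fix n
          have i: "integrable M (\<lambda>x. \<bar>indicator E ((T ^^ n) (U x)) - indicator E ((T ^^ n) x) :: real\<bar>)"
            if [measurable]: "E \<in> sets M" for E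
            by (rule integrable_bounded[where B = 1], measurable) (auto simp: indicator_def)
          have "d (indicator (\<Union>i<k. A i)) n
              \<le> (\<integral>x. (\<Sum>i<k. \<bar>indicator (A i) ((T ^^ n) (U x)) - indicator (A i) ((T ^^ n) x)\<bar>) \<partial>M)"
            unfolding d_def
          proof (rule integral_mono)
            show "\<bar>indicator (\<Union>i<k. A i) ((T ^^ n) (U x)) - indicator (\<Union>i<k. A i) ((T ^^ n) x)\<bar>
              \<le> (\<Sum>i<k. \<bar>indicator (A i) ((T ^^ n) (U x)) - indicator (A i) ((T ^^ n) x) :: real\<bar>)" for x
              unfolding sum sum_subtractf[symmetric] by (rule sum_abs)
          qed (intro i Bochner_Integration.integrable_sum; measurable)+
          also have "\<dots> = (\<Sum>i<k. d (indicator (A i)) n)"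
            unfolding d_def by (intro Bochner_Integration.integral_sum i) measurable
          finally show "norm (d (indicator (\<Union>i<k. A i)) n) \<le> (\<Sum>i<k. d (indicator (A i)) n)"
            by (simp add: d_def)
        qed
      qed
    qed (auto simp: indicator_def)
  qed
  then show ?thesis by (simp add: d_def[abs_def])
qed

text \<open>For a \<open>T\<close>-invariant set \<open>E\<close> the powers of \<open>T\<close>
  disappear from \<open>contracting_indicator_L1\<close>, leaving a constant sequence with limit
  \<open>0\<close>: \<open>E\<close> is \<open>U\<close>-invariant up to a null set. As
  \<open>ergodic\<close> speaks of strictly invariant sets, the conclusion is drawn from ergodic
  averages of \<open>U\<close>.\<close>

lemma contracting_imp_ergodic:
  fixes M :: "'a::metric_space measure"
  assumes "prob_space M" and sets: "sets M = sets borel"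
    and T: "measure_preserving M T" and U: "measure_preserving M U" and erg: "ergodic M U"
    and contr: "contracting M T U"
  shows "ergodic M T"
  unfolding ergodic_def
proof (intro ballI impI)
  interpret prob_space M by fact
  have space: "space M = UNIV" using sets_eq_imp_space_eq[OF sets] by simp
  note [measurable] = measure_preservingD(1)[OF U]
  fix E assume E [measurable]: "E \<in> sets M" and inv: "T -` E \<inter> space M = E"
  then have TE: "T x \<in> E \<longleftrightarrow> x \<in> E" for x by (auto simp: space)
  have "(T ^^ n) x \<in> E \<longleftrightarrow> x \<in> E" for n x by (induction n) (simp_all add: TE)
  then have "indicator E ((T ^^ n) x) = (indicator E x :: real)" for n x by (simp add: indicator_def)
  with contracting_indicator_L1[OF assms(1) sets T U contr, of E] E
  have "(\<integral>x. \<bar>indicator E (U x) - indicator E x :: real\<bar> \<partial>M) = 0"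
    by (simp add: sets LIMSEQ_const_iff)
  moreover have "integrable M (\<lambda>x. \<bar>indicator E (U x) - indicator E x :: real\<bar>)"
    by (rule integrable_bounded[where B = 1], measurable) (auto simp: indicator_def)
  ultimately have AE1: "AE x in M. indicator E (U x) = (indicator E x :: real)"
    by (subst (asm) integral_nonneg_eq_0_iff_AE) auto
  \<comment> \<open>Almost surely all iterates are controlled at once, so the averages along the
    \<open>U\<close>-orbit are constant from \<open>n = 1\<close> on.\<close>
  have "AE x in M. \<forall>j. indicator E ((U ^^ j) x) = (indicator E x :: real)"
  proof (subst AE_all_countable, intro allI)
    fix j show "AE x in M. indicator E ((U ^^ j) x) = (indicator E x :: real)"
    proof (induction j)
      case (Suc j)
      from measure_preserving_AE[OF measure_preserving_funpow[OF U] AE1, of j] Suc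
      show ?case by eventually_elim simp
    qed simp
  qed
  moreover have "AE x in M. (\<lambda>n. (\<Sum>j<n. indicator E ((U ^^ j) x)) / n) \<longlonglongrightarrow> prob E"
    using ergodic_average_tendsto[OF U erg, of "indicator E" 1] by simp
  ultimately have "AE x in M. indicator E x = prob E"
  proof eventually_elim
    fix x assume eq: "\<forall>j. indicator E ((U ^^ j) x) = (indicator E x :: real)"
      and lim: "(\<lambda>n. (\<Sum>j<n. indicator E ((U ^^ j) x)) / n) \<longlonglongrightarrow> prob E"
    have "(\<lambda>n. (\<Sum>j<n. indicator E ((U ^^ j) x)) / n) \<longlonglongrightarrow> (indicator E x :: real)"
    proof (rule tendsto_eventually, rule eventually_sequentiallyI)
      fix n :: nat assume "n \<ge> 1"
      then show "(\<Sum>j<n. indicator E ((U ^^ j) x)) / n = (indicator E x :: real)" by (simp add: eq)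
    qed
    with lim show "indicator E x = prob E" using LIMSEQ_unique by fastforce
  qed
  \<comment> \<open>A single point suffices, as an indicator takes only the values \<open>0\<close>
    and \<open>1\<close>.\<close>
  from eventually_happens'[OF ae_filter_bot this] obtain x where x: "indicator E x = prob E" by blast
  have "prob E = 0 \<or> prob E = 1" unfolding x[symmetric] by (simp add: indicator_def)
  then show "prob E = 0 \<or> prob E = prob (space M)" by (simp add: prob_space)
qed

section \<open>Projective space\<close>

lemma projective_cases:
  obtains v :: "real^'m::finite" where "v \<noteq> 0" "p = proj_class v"
proof -
  have "\<exists>v. v \<noteq> 0 \<and> p = proj_class v"
    by (induction p rule: projective.abs_induct) (auto simp: proportional_def)
  then show thesis using that by blast
qed

lemma proportional_refl: "v \<noteq> 0 \<Longrightarrow> proportional v v"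
  unfolding proportional_def by (auto intro!: exI[of _ "1::real"])

lemma proj_class_scaleR: "v \<noteq> 0 \<Longrightarrow> c \<noteq> 0 \<Longrightarrow> proj_class (c *\<^sub>R v) = proj_class v"
  by (rule sym, rule Quotient3_rel_abs[OF Quotient3_projective]) (auto simp: proportional_def)

text \<open>
  The entries of the orthogonal projection onto a line. The expansion ratio of a matrix along the
  line is a quadratic form in the matrix with these coefficients, whence joint measurability.
\<close>

lift_definition proj_coord :: "'m \<Rightarrow> 'm \<Rightarrow> 'm::finite projective \<Rightarrow> real"
  is "\<lambda>i j v. v $ i * v $ j / (norm v)\<^sup>2"
  by (auto simp: proportional_def fun_eq_iff power_mult_distrib) (simp add: power2_eq_square)

lemma proj_coord_measurable [measurable]:
  "proj_coord i j \<in> borel_measurable (borel :: 'm::finite projective measure)"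
proof (rule borel_measurable_continuous_onI)
  have eq: "proj_coord i j (proj_class v) = v $ i * v $ j / (norm v)\<^sup>2" if "v \<noteq> 0" for v :: "real^'m"
    using that by (simp add: proj_coord.abs_eq eq_onp_def proportional_refl)
  show "continuous_on UNIV (proj_coord i j :: 'm projective \<Rightarrow> real)"
    unfolding continuous_on_open_vimage[OF open_UNIV]
  proof safe
    fix S :: "real set" assume S: "open S"
    \<comment> \<open>Openness of a subset of projective space means openness of its cone without
      the origin, and there the denominator does not vanish.\<close>
    have cont: "continuous_on (-{0}) (\<lambda>v::real^'m. v $ i * v $ j / (norm v)\<^sup>2)"
      by (intro continuous_intros) auto
    have "open (- {0::real^'m})" by (simp add: open_Compl)
    from iffD1[OF continuous_on_open_vimage[OF this] cont] S
    have "open ((\<lambda>v. v $ i * v $ j / (norm v)\<^sup>2) -` S \<inter> (- {0::real^'m}))" by blast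
    also have "(\<lambda>v. v $ i * v $ j / (norm v)\<^sup>2) -` S \<inter> (- {0::real^'m})
        = {v. v \<noteq> 0 \<and> proj_class v \<in> proj_coord i j -` S \<inter> UNIV}"
      using eq by auto
    finally show "open (proj_coord i j -` S \<inter> (UNIV :: 'm projective set))"
      unfolding open_projective_def .
  qed
qed

lemma log_growth_eq:
  "log_growth C x p N =
    ln (sqrt (\<Sum>i\<in>UNIV. \<Sum>j\<in>UNIV. \<Sum>k\<in>UNIV. C x (int N) $ i $ j * C x (int N) $ i $ k * proj_coord j k p))"
  for C :: "'a \<Rightarrow> int \<Rightarrow> real^'m::finite^'m"
proof (cases p rule: projective_cases)
  case (1 v)
  define A where "A = C x (int N)"
  have coord: "proj_coord i j p = v $ i * v $ j / (norm v)\<^sup>2" for i j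
    using 1 by (simp add: proj_coord.abs_eq eq_onp_def proportional_refl)
  have lg: "log_growth C x p N = ln (norm (A *v v) / norm v)"
    using 1 by (simp add: log_growth.abs_eq eq_onp_def proportional_refl A_def)
  have "(norm (A *v v))\<^sup>2 = (\<Sum>i\<in>UNIV. (\<Sum>j\<in>UNIV. A $ i $ j * v $ j)\<^sup>2)"
    by (simp add: norm_vec_def L2_set_def matrix_vector_mult_def sum_nonneg)
  also have "\<dots> = (\<Sum>i\<in>UNIV. \<Sum>j\<in>UNIV. \<Sum>k\<in>UNIV. A $ i $ j * A $ i $ k * (v $ j * v $ k))"
    by (simp add: power2_eq_square sum_product mult_ac)
  finally have "(norm (A *v v) / norm v)\<^sup>2
      = (\<Sum>i\<in>UNIV. \<Sum>j\<in>UNIV. \<Sum>k\<in>UNIV. A $ i $ j * A $ i $ k * proj_coord j k p)"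
    by (simp add: coord power_divide sum_divide_distrib)
  then have "sqrt (\<Sum>i\<in>UNIV. \<Sum>j\<in>UNIV. \<Sum>k\<in>UNIV. A $ i $ j * A $ i $ k * proj_coord j k p)
      = norm (A *v v) / norm v"
    by (metis divide_nonneg_nonneg norm_ge_zero real_sqrt_unique)
  then show ?thesis by (simp add: lg A_def)
qed

lemma sets_proj_measure [measurable_cong]: "sets proj_measure = sets borel"
  by (simp add: proj_measure_def)

lemma space_proj_measure [simp]: "space proj_measure = UNIV"
  by (simp add: proj_measure_def)

text \<open>\<open>log_growth_eq\<close> separates the variables: matrix entries depend on
  \<open>x\<close> alone and coordinates on \<open>v\<close> alone, so joint measurability reduces
  to sums of products.\<close>

lemma log_growth_measurable:
  fixes C :: "'a \<Rightarrow> int \<Rightarrow> real^'m::finite^'m"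
  assumes "measurable_cocycle M \<Phi> C"
  shows "(\<lambda>(x, v). log_growth C x v N) \<in> borel_measurable (M \<Otimes>\<^sub>M proj_measure)"
proof -
  have C: "(\<lambda>(x, r). C x r) \<in> borel_measurable (M \<Otimes>\<^sub>M count_space UNIV)"
    using assms by (simp add: measurable_cocycle_def)
  have [measurable]: "(\<lambda>x. C x (int N)) \<in> borel_measurable M"
    using measurable_compose[OF _ C, of "\<lambda>x. (x, int N)"] by simp
  have comp: "(\<lambda>v :: 'b::real_normed_vector^'m. v $ i) \<in> borel_measurable borel" for i :: 'm
    by (intro borel_measurable_continuous_onI continuous_intros)
  have [measurable]: "(\<lambda>x. C x (int N) $ i $ j) \<in> borel_measurable M" for i j
    by (intro measurable_compose[OF _ comp]) simp
  show ?thesis unfolding log_growth_eq by measurable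
qed

text \<open>
  Only the part of the cone over a null set that lies in the unit ball is known to be null. It is
  pulled back by the inverse matrix, rescaled so that the unit ball is covered again.
\<close>

lemma proj_act_quasi_invariant:
  fixes A :: "real^'m::finite^'m"
  assumes A: "invertible A" and AE: "AE w in proj_measure. Q w"
  shows "AE v in proj_measure. Q (proj_act A v)"
proof -
  define b where "b = ball (0::real^'m) 1"
  have sets: "F \<in> sets borel \<Longrightarrow> proj_class -` F \<in> sets borel" for F :: "'m projective set"
    using measurable_sets[OF proj_class_measurable, of F] by simp
  have "\<not> unit_ball_vol (real CARD('m)) \<le> 0"
    using unit_ball_vol_pos[of "real CARD('m)"] by linarith
  then have ball: "emeasure lborel b \<noteq> 0" "emeasure lborel b \<noteq> \<top>"
    by (auto simp: b_def emeasure_ball ennreal_eq_0_iff)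
  have null: "F \<in> null_sets proj_measure \<longleftrightarrow> b \<inter> proj_class -` F \<in> null_sets lborel"
    if F: "F \<in> sets borel" for F :: "'m projective set"
    using F sets[OF F] ball
    by (auto simp: null_sets_def proj_measure_def emeasure_distr b_def)
  obtain E where "{w \<in> space proj_measure. \<not> Q w} \<subseteq> E" "emeasure proj_measure E = 0" "E \<in> sets proj_measure"
    using AE_E[OF AE] .
  then have E: "{w. \<not> Q w} \<subseteq> E" "E \<in> sets borel" "E \<in> null_sets proj_measure"
    by (simp_all add: null_setsI sets_proj_measure)
  obtain A' where A': "A' ** A = mat 1" using A by (auto simp: invertible_def)
  have A'A: "A' *v (A *v v) = v" for v
    using A' by (simp add: matrix_vector_mul_assoc)
  \<comment> \<open>Dividing the image of a vector of the unit ball by the operator bound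
    \<open>c\<close> brings it back into the ball without changing its line.\<close>
  obtain c where c: "c > 0" "\<And>v. norm (A *v v) \<le> c * norm v"
    by (rule linear_bounded_pos[of "(*v) A"]) auto
  have neg: "negligible (b \<inter> proj_class -` E)"
    using null[OF E(2)] E(3) by (simp add: negligible_iff_null_sets null_sets_completionI)
  have "negligible ((\<lambda>u. c *\<^sub>R (A' *v u)) ` (b \<inter> proj_class -` E))"
  proof (rule negligible_differentiable_image_negligible[OF _ neg])
    have "linear (\<lambda>u. c *\<^sub>R (A' *v u))"
      by (intro linear_compose_scale_right matrix_vector_mul_linear)
    then show "(\<lambda>u. c *\<^sub>R (A' *v u)) differentiable_on b \<inter> proj_class -` E"
      by (rule linear_imp_differentiable_on)
  qed simp
  \<comment> \<open>The origin is added because \<open>proj_class 0\<close> is unspecified.\<close>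
  then have "negligible (insert 0 ((\<lambda>u. c *\<^sub>R (A' *v u)) ` (b \<inter> proj_class -` E)))" by simp
  moreover have "b \<inter> proj_class -` (proj_act A -` E)
      \<subseteq> insert 0 ((\<lambda>u. c *\<^sub>R (A' *v u)) ` (b \<inter> proj_class -` E))"
  proof
    fix v assume v: "v \<in> b \<inter> proj_class -` (proj_act A -` E)"
    show "v \<in> insert 0 ((\<lambda>u. c *\<^sub>R (A' *v u)) ` (b \<inter> proj_class -` E))"
    proof (cases "v = 0")
      case False
      define u where "u = (1 / c) *\<^sub>R (A *v v)"
      have "A *v v \<noteq> 0" using A'A[of v] False by auto
      then have "proj_class u = proj_act A (proj_class v)"
        using c(1) False by (simp add: u_def proj_class_scaleR proj_act_class[OF A])
      moreover have "norm u < 1"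
      proof -
        have "norm v < 1" using v by (simp add: b_def)
        then have "c * norm v < c * 1" using c(1) by (intro mult_strict_left_mono)
        then have "norm (A *v v) < c" using c(2)[of v] by linarith
        then show ?thesis using c(1) by (simp add: u_def)
      qed
      moreover have "v = c *\<^sub>R (A' *v u)"
        using c(1) by (simp add: u_def matrix_vector_mult_scaleR A'A)
      moreover have "proj_act A (proj_class v) \<in> E" using v by simp
      ultimately have "u \<in> b \<inter> proj_class -` E" "v = c *\<^sub>R (A' *v u)" by (simp_all add: b_def)
      then show ?thesis by blast
    qed simp
  qed
  ultimately have "negligible (b \<inter> proj_class -` (proj_act A -` E))"
    by (rule negligible_subset)
  moreover have PE: "proj_act A -` E \<in> sets borel"
    using measurable_sets[OF proj_act_measurable E(2)] by simp
  ultimately have "proj_act A -` E \<in> null_sets proj_measure"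
    using sets[OF PE] by (simp add: null negligible_iff_null_sets null_sets_completion_iff b_def)
  then show ?thesis by (rule AE_I') (use E in auto)
qed

section \<open>Asymptotic independence\<close>

text \<open>By contraction the factor at time \<open>N\<close> is compatible with \<open>U\<close>,
  so \<open>U\<close> first splits off \<open>A\<close> while \<open>B\<close> stays inside
  \<open>k N\<close>; then \<open>T\<close> separates \<open>h N\<close> from
  \<open>B\<close>.\<close>

lemma (in prob_space) asymptotic_independence:
  fixes h :: "nat \<Rightarrow> 'a \<Rightarrow> real"
  assumes T: "measure_preserving M T" and ergT: "ergodic M T"
    and U: "measure_preserving M U" and ergU: "ergodic M U"
    and h [measurable]: "\<And>N. h N \<in> borel_measurable M" and h1: "\<And>N x. \<bar>h N x\<bar> \<le> 1"
    and hT: "AE x in M. (\<lambda>N. h N (T x) - h N x) \<longlonglongrightarrow> 0"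
    and hU: "AE x in M. (\<lambda>N. h N (U x) - h N x) \<longlonglongrightarrow> 0"
    and A [measurable]: "A \<in> sets M" and B [measurable]: "B \<in> sets M"
    and contr: "(\<lambda>N. \<integral>x. \<bar>indicator B ((T ^^ N) (U x)) - indicator B ((T ^^ N) x) :: real\<bar> \<partial>M) \<longlonglongrightarrow> 0"
  shows "(\<lambda>N. (\<integral>x. indicator A x * h N x * indicator B ((T ^^ N) x) \<partial>M)
      - prob A * prob B * (\<integral>x. h N x \<partial>M)) \<longlonglongrightarrow> 0"
proof -
  have Tn: "measure_preserving M (T ^^ n)" for n by (rule measure_preserving_funpow[OF T])
  note [measurable] = measure_preservingD(1)[OF T] measure_preservingD(1)[OF U] measure_preservingD(1)[OF Tn]
  have h2: "\<bar>h N x - h N y\<bar> \<le> 2" for N x y using h1[of N x] h1[of N y] by linarith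
  have L1: "(\<lambda>N. \<integral>x. \<bar>h N (W x) - h N x\<bar> \<partial>M) \<longlonglongrightarrow> 0"
    if [measurable]: "W \<in> measurable M M" and W: "AE x in M. (\<lambda>N. h N (W x) - h N x) \<longlonglongrightarrow> 0" for W
  proof -
    have "(\<lambda>N. \<integral>x. \<bar>h N (W x) - h N x\<bar> \<partial>M) \<longlonglongrightarrow> (\<integral>x. 0 \<partial>M)"
    proof (rule integral_dominated_convergence[where w = "\<lambda>_. 2"])
      show "AE x in M. (\<lambda>N. \<bar>h N (W x) - h N x\<bar>) \<longlonglongrightarrow> 0"
        using W by eventually_elim (rule tendsto_rabs_zero)
    qed (use h2 in auto)
    then show ?thesis by simp
  qed
  define k where "k N x = h N x * indicator B ((T ^^ N) x)" for N x
  have [measurable]: "k N \<in> borel_measurable M" for N unfolding k_def by measurable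
  have k1: "\<bar>k N x\<bar> \<le> 1" for N x using h1[of N x] by (simp add: k_def indicator_def)
  have kU: "(\<lambda>N. \<integral>x. \<bar>k N (U x) - k N x\<bar> \<partial>M) \<longlonglongrightarrow> 0"
  proof (rule Lim_null_comparison)
    show "(\<lambda>N. (\<integral>x. \<bar>h N (U x) - h N x\<bar> \<partial>M)
        + (\<integral>x. \<bar>indicator B ((T ^^ N) (U x)) - indicator B ((T ^^ N) x) :: real\<bar> \<partial>M)) \<longlonglongrightarrow> 0"
      using tendsto_add[OF L1[OF _ hU] contr] by simp
    show "\<forall>\<^sub>F N in sequentially. norm (\<integral>x. \<bar>k N (U x) - k N x\<bar> \<partial>M) \<le> (\<integral>x. \<bar>h N (U x) - h N x\<bar> \<partial>M)
        + (\<integral>x. \<bar>indicator B ((T ^^ N) (U x)) - indicator B ((T ^^ N) x) :: real\<bar> \<partial>M)"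
    proof (intro always_eventually allI)
      fix N
      have i1: "integrable M (\<lambda>x. \<bar>h N (U x) - h N x\<bar>)"
        by (rule integrable_bounded[where B = 2]) (use h2 in auto)
      have i2: "integrable M (\<lambda>x. \<bar>indicator B ((T ^^ N) (U x)) - indicator B ((T ^^ N) x) :: real\<bar>)"
        by (rule integrable_bounded[where B = 1], measurable) (auto simp: indicator_def)
      have k2: "\<bar>k N (U x) - k N x\<bar> \<le> 2" for x using k1[of N x] k1[of N "U x"] by linarith
      have i3: "integrable M (\<lambda>x. \<bar>k N (U x) - k N x\<bar>)"
        by (rule integrable_bounded[where B = 2]) (use k2 in auto)
      have "(\<integral>x. \<bar>k N (U x) - k N x\<bar> \<partial>M) \<le> (\<integral>x. \<bar>h N (U x) - h N x\<bar>
          + \<bar>indicator B ((T ^^ N) (U x)) - indicator B ((T ^^ N) x)\<bar> \<partial>M)"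
      proof (rule integral_mono)
        \<comment> \<open>The product rule for differences, with both factors bounded by
          \<open>1\<close>.\<close>
        show "\<bar>k N (U x) - k N x\<bar> \<le> \<bar>h N (U x) - h N x\<bar>
          + \<bar>indicator B ((T ^^ N) (U x)) - indicator B ((T ^^ N) x)\<bar>" for x
          using h1[of N x] h1[of N "U x"] by (auto simp: k_def indicator_def)
      qed (use i1 i2 i3 in auto)
      then show "norm (\<integral>x. \<bar>k N (U x) - k N x\<bar> \<partial>M) \<le> (\<integral>x. \<bar>h N (U x) - h N x\<bar> \<partial>M)
        + (\<integral>x. \<bar>indicator B ((T ^^ N) (U x)) - indicator B ((T ^^ N) x) :: real\<bar> \<partial>M)"
        using i1 i2 by simp
    qed
  qed
  \<comment> \<open>Here \<open>R N\<close> is the identity and the test function is the indicator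
    of \<open>A\<close>.\<close>
  have "(\<lambda>N. (\<integral>x. k N x * indicator A x \<partial>M) - (\<integral>x. k N x \<partial>M) * (\<integral>x. indicator A x \<partial>M)) \<longlonglongrightarrow> 0"
    by (rule asymptotically_invariant_decorrelates[OF U ergU _ k1 kU measure_preserving_id])
      (auto simp: indicator_def)
  then have first: "(\<lambda>N. (\<integral>x. k N x * indicator A x \<partial>M) - (\<integral>x. k N x \<partial>M) * prob A) \<longlonglongrightarrow> 0"
    by simp
  \<comment> \<open>Here \<open>R N\<close> is \<open>T ^^ N\<close> and the test function is the
    indicator of \<open>B\<close>.\<close>
  have "(\<lambda>N. (\<integral>x. h N x * indicator B ((T ^^ N) x) \<partial>M) - (\<integral>x. h N x \<partial>M) * (\<integral>x. indicator B x \<partial>M)) \<longlonglongrightarrow> 0"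
    by (rule asymptotically_invariant_decorrelates[OF T ergT _ h1 L1[OF _ hT] Tn])
      (auto simp: indicator_def funpow_swap1)
  then have "(\<lambda>N. (\<integral>x. k N x \<partial>M) - (\<integral>x. h N x \<partial>M) * prob B) \<longlonglongrightarrow> 0"
    by (simp add: k_def)
  from tendsto_add[OF first tendsto_mult_right_zero[OF this, of "prob A"]]
  show ?thesis by (simp add: k_def algebra_simps)
qed

section \<open>Averages over directions\<close>

text \<open>Continuity has to be uniform because \<open>s N\<close> may run off to infinity: only
  its difference from \<open>f N w\<close> is controlled.\<close>

lemma (in prob_space) integral_uniformly_continuous_tendsto:
  fixes f :: "nat \<Rightarrow> 'a \<Rightarrow> real" and g :: "real \<Rightarrow> real"
  assumes f [measurable]: "\<And>N. f N \<in> borel_measurable M"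
    and g: "uniformly_continuous_on UNIV g" and g1: "\<And>t. \<bar>g t\<bar> \<le> 1"
    and lim: "AE w in M. (\<lambda>N. f N w - s N) \<longlonglongrightarrow> 0"
  shows "(\<lambda>N. (\<integral>w. g (f N w) \<partial>M) - g (s N)) \<longlonglongrightarrow> 0"
proof -
  have [measurable]: "g \<in> borel_measurable borel"
    by (intro borel_measurable_continuous_onI uniformly_continuous_imp_continuous g)
  have "(\<lambda>N. \<integral>w. g (f N w) - g (s N) \<partial>M) \<longlonglongrightarrow> (\<integral>w. 0 \<partial>M)"
  proof (rule integral_dominated_convergence[where w = "\<lambda>_. 2"])
    show "AE w in M. (\<lambda>N. g (f N w) - g (s N)) \<longlonglongrightarrow> 0"
      using lim
    proof eventually_elim
      fix w assume "(\<lambda>N. f N w - s N) \<longlonglongrightarrow> 0"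
      then have "(\<lambda>N. dist (f N w) (s N)) \<longlonglongrightarrow> 0" by (simp add: dist_real_def tendsto_rabs_zero_iff)
      then have "(\<lambda>N. dist (g (f N w)) (g (s N))) \<longlonglongrightarrow> 0"
        using g by (simp add: uniformly_continuous_on_sequentially)
      then show "(\<lambda>N. g (f N w) - g (s N)) \<longlonglongrightarrow> 0" by (simp add: dist_real_def tendsto_rabs_zero_iff)
    qed
    show "AE w in M. norm (g (f N w) - g (s N)) \<le> 2" for N
    proof (rule AE_I2)
      fix w show "norm (g (f N w) - g (s N)) \<le> 2"
        using g1[of "f N w"] g1[of "s N"] unfolding real_norm_def by linarith
    qed
  qed auto
  moreover have "integrable M (\<lambda>w. g (f N w))" for N
    by (rule integrable_bounded[where B = 1]) (use g1 in auto)
  ultimately show ?thesis by (simp add: prob_space)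
qed

text \<open>
  A single direction \<open>v\<close> is compared with almost all directions at \<open>x\<close> and, through
  \<open>proj_act Q v\<close>, with almost all directions at \<open>y\<close>.
\<close>

lemma direction_averages_asymptotically_equal:
  fixes C :: "'a \<Rightarrow> int \<Rightarrow> real^'m::finite^'m" and g :: "real \<Rightarrow> real"
  assumes Q: "invertible Q" and V: "\<And>N. V N > 0"
    and mx: "\<And>N. (\<lambda>v. log_growth C x v N) \<in> borel_measurable proj_measure"
    and my: "\<And>N. (\<lambda>v. log_growth C y v N) \<in> borel_measurable proj_measure"
    and g: "uniformly_continuous_on UNIV g" "\<And>t. \<bar>g t\<bar> \<le> 1"
    and xy: "AE v in proj_measure. (\<lambda>N. \<bar>log_growth C x v N - log_growth C y (proj_act Q v) N\<bar> / V N) \<longlonglongrightarrow> 0"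
    and xx: "AE v in proj_measure. AE w in proj_measure. (\<lambda>N. \<bar>log_growth C x v N - log_growth C x w N\<bar> / V N) \<longlonglongrightarrow> 0"
    and yy: "AE v in proj_measure. AE w in proj_measure. (\<lambda>N. \<bar>log_growth C y v N - log_growth C y w N\<bar> / V N) \<longlonglongrightarrow> 0"
  shows "(\<lambda>N. (\<integral>v. g ((log_growth C y v N - a N) / V N) \<partial>proj_measure)
      - (\<integral>v. g ((log_growth C x v N - a N) / V N) \<partial>proj_measure)) \<longlonglongrightarrow> 0"
proof -
  interpret prob_space "proj_measure :: 'm projective measure" by (rule prob_space_proj_measure)
  note [measurable] = mx my
  \<comment> \<open>By quasi-invariance \<open>proj_act Q v\<close> avoids the exceptional
    directions at \<open>y\<close> for almost every \<open>v\<close>.\<close>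
  from proj_act_quasi_invariant[OF Q yy] xx xy
  have "AE v in proj_measure. 
    (AE w in proj_measure. (\<lambda>N. \<bar>log_growth C y (proj_act Q v) N - log_growth C y w N\<bar> / V N) \<longlonglongrightarrow> 0) \<and>
    (AE w in proj_measure. (\<lambda>N. \<bar>log_growth C x v N - log_growth C x w N\<bar> / V N) \<longlonglongrightarrow> 0) \<and>
    (\<lambda>N. \<bar>log_growth C x v N - log_growth C y (proj_act Q v) N\<bar> / V N) \<longlonglongrightarrow> 0"
    by eventually_elim blast
  from eventually_happens'[OF ae_filter_bot this] obtain v
    where y: "AE w in proj_measure. (\<lambda>N. \<bar>log_growth C y (proj_act Q v) N - log_growth C y w N\<bar> / V N) \<longlonglongrightarrow> 0"
      and x: "AE w in proj_measure. (\<lambda>N. \<bar>log_growth C x v N - log_growth C x w N\<bar> / V N) \<longlonglongrightarrow> 0"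
      and v: "(\<lambda>N. \<bar>log_growth C x v N - log_growth C y (proj_act Q v) N\<bar> / V N) \<longlonglongrightarrow> 0"
    by blast
  \<comment> \<open>The normalised growth along the single direction \<open>v\<close> at
    \<open>x\<close> is the common reference for both averages.\<close>
  define s where "s N = (log_growth C x v N - a N) / V N" for N
  have signed: "(\<lambda>N. (p N - q N) / V N) \<longlonglongrightarrow> 0" if "(\<lambda>N. \<bar>p N - q N\<bar> / V N) \<longlonglongrightarrow> 0" for p q :: "nat \<Rightarrow> real"
  proof -
    have "\<bar>p N - q N\<bar> / V N = \<bar>(p N - q N) / V N\<bar>" for N using V[of N] by simp
    then show ?thesis using that by (simp only: tendsto_rabs_zero_iff)
  qed
  have "AE w in proj_measure. (\<lambda>N. (log_growth C x w N - a N) / V N - s N) \<longlonglongrightarrow> 0"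
    using x
  proof eventually_elim
    fix w assume "(\<lambda>N. \<bar>log_growth C x v N - log_growth C x w N\<bar> / V N) \<longlonglongrightarrow> 0"
    from tendsto_minus[OF signed[OF this]]
    show "(\<lambda>N. (log_growth C x w N - a N) / V N - s N) \<longlonglongrightarrow> 0"
      by (simp add: s_def diff_divide_distrib)
  qed
  note 1 = integral_uniformly_continuous_tendsto[OF _ g this]
  have "AE w in proj_measure. (\<lambda>N. (log_growth C y w N - a N) / V N - s N) \<longlonglongrightarrow> 0"
    using y
  proof eventually_elim
    fix w assume "(\<lambda>N. \<bar>log_growth C y (proj_act Q v) N - log_growth C y w N\<bar> / V N) \<longlonglongrightarrow> 0"
    \<comment> \<open>Direction \<open>w\<close> at \<open>y\<close> is compared with
      \<open>proj_act Q v\<close> at \<open>y\<close>, and this in turn with \<open>v\<close> at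
      \<open>x\<close>.\<close>
    from tendsto_minus[OF tendsto_add[OF signed[OF this] signed[OF v]]]
    show "(\<lambda>N. (log_growth C y w N - a N) / V N - s N) \<longlonglongrightarrow> 0"
      by (simp add: s_def diff_divide_distrib)
  qed
  note 2 = integral_uniformly_continuous_tendsto[OF _ g this]
  show ?thesis using tendsto_diff[OF 2 1] by simp
qed

section \<open>Approximation of intervals by trapezoids\<close>

text \<open>Continuity from above makes small windows around a non-atom light. A law on the line has
  only countably many atoms, so some radius in an uncountable interval keeps all window end points
  off them.\<close>

lemma (in prob_space) small_radius_avoiding_atoms:
  fixes X :: "'a \<Rightarrow> real"
  assumes X [measurable]: "X \<in> borel_measurable M" and e: "e > 0"
    and a: "\<P>(w in M. X w = a) = 0" and b: "\<P>(w in M. X w = b) = 0"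
  obtains \<delta> where "\<delta> > 0"
    "\<And>c. c \<in> {a, b} \<Longrightarrow> \<P>(w in M. X w \<in> {c - \<delta>, c + \<delta>}) = 0"
    "\<And>c. c \<in> {a, b} \<Longrightarrow> \<P>(w in M. X w \<in> {c - \<delta><..<c + \<delta>}) < e"
proof -
  have small: "\<exists>\<eta>>0. \<P>(w in M. X w \<in> {c - \<eta><..<c + \<eta>}) < e"
    if c: "\<P>(w in M. X w = c) = 0" for c
  proof -
    define F where "F n = {w \<in> space M. X w \<in> {c - 1 / Suc n<..<c + 1 / Suc n}}" for n
    have "(\<lambda>n. prob (F n)) \<longlonglongrightarrow> prob (\<Inter>n. F n)"
    proof (rule finite_Lim_measure_decseq)
      show "range F \<subseteq> sets M" unfolding F_def by auto
      show "decseq F"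
      proof (rule decseq_SucI)
        fix n
        have "1 / real (Suc (Suc n)) \<le> 1 / Suc n" by (simp add: field_simps)
        then show "F (Suc n) \<subseteq> F n" unfolding F_def by auto
      qed
    qed
    also have "(\<Inter>n. F n) = {w \<in> space M. X w = c}"
    proof (intro set_eqI iffI)
      fix w assume w: "w \<in> (\<Inter>n. F n)"
      have "X w = c"
      proof (rule ccontr)
        assume "X w \<noteq> c"
        then have "\<bar>X w - c\<bar> > 0" by simp
        then obtain n where "inverse (real (Suc n)) < \<bar>X w - c\<bar>" using reals_Archimedean by blast
        moreover have "w \<in> F n" using w by blast
        ultimately show False by (auto simp: F_def inverse_eq_divide)
      qed
      with w show "w \<in> {w \<in> space M. X w = c}" by (auto simp: F_def)
    qed (auto simp: F_def)
    finally have "(\<lambda>n. prob (F n)) \<longlonglongrightarrow> 0" by (simp add: c)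
    from order_tendstoD(2)[OF this e] obtain n where "prob (F n) < e"
      by (auto simp: eventually_sequentially)
    then show ?thesis by (intro exI[of _ "1 / Suc n"]) (simp add: F_def)
  qed
  obtain \<eta>a \<eta>b where \<eta>: "\<eta>a > 0" "\<P>(w in M. X w \<in> {a - \<eta>a<..<a + \<eta>a}) < e"
      "\<eta>b > 0" "\<P>(w in M. X w \<in> {b - \<eta>b<..<b + \<eta>b}) < e"
    using small[OF a] small[OF b] by blast
  interpret D: prob_space "distr M borel X" by (rule prob_space_distr) simp
  define N where "N = {t. D.prob {t} \<noteq> 0}"
  have N: "countable N" unfolding N_def by (rule D.countable_support)
  have atom: "\<P>(w in M. X w = t) = D.prob {t}" for t
    by (subst measure_distr) (auto intro!: arg_cong[where f = prob])
  \<comment> \<open>The countably many radii that would put \<open>c - \<delta>\<close> or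
    \<open>c + \<delta>\<close> on an atom, for \<open>c\<close> equal to \<open>a\<close> or
    \<open>b\<close>.\<close>
  define Z where "Z = (\<lambda>t. a - t) ` N \<union> (\<lambda>t. t - a) ` N \<union> (\<lambda>t. b - t) ` N \<union> (\<lambda>t. t - b) ` N"
  have "countable Z" unfolding Z_def using N by (intro countable_Un countable_image)
  moreover have "uncountable {0<..<min \<eta>a \<eta>b}" using \<eta> by (simp add: uncountable_open_interval)
  ultimately have "\<not> {0<..<min \<eta>a \<eta>b} \<subseteq> Z" using countable_subset by blast
  then obtain \<delta> where \<delta>: "0 < \<delta>" "\<delta> < \<eta>a" "\<delta> < \<eta>b" "\<delta> \<notin> Z" by (meson greaterThanLessThan_iff min_less_iff_conj subsetI)
  have notN: "c - \<delta> \<notin> N \<and> c + \<delta> \<notin> N" if "c \<in> {a, b}" for c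
  proof (rule conjI; rule notI)
    assume "c - \<delta> \<in> N"
    then have "c - (c - \<delta>) \<in> Z" using that unfolding Z_def by blast
    then show False using \<delta> by simp
  next
    assume "c + \<delta> \<in> N"
    then have "(c + \<delta>) - c \<in> Z" using that unfolding Z_def by blast
    then show False using \<delta> by simp
  qed
  show thesis
  proof
    show "\<delta> > 0" by fact
    fix c assume c: "c \<in> {a, b}"
    have "\<P>(w in M. X w \<in> {c - \<delta>, c + \<delta>})
        = prob ({w \<in> space M. X w = c - \<delta>} \<union> {w \<in> space M. X w = c + \<delta>})"
      by (rule arg_cong[where f = prob]) auto
    also have "\<dots> \<le> prob {w \<in> space M. X w = c - \<delta>} + prob {w \<in> space M. X w = c + \<delta>}"
      by (rule measure_Un_le) measurable
    also have "\<dots> = 0" using notN[OF c] by (simp add: atom N_def)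
    finally show "\<P>(w in M. X w \<in> {c - \<delta>, c + \<delta>}) = 0"
      by (simp add: measure_le_0_iff)
    have mono: "\<P>(w in M. X w \<in> {c - \<delta><..<c + \<delta>}) \<le> \<P>(w in M. X w \<in> {c - \<eta><..<c + \<eta>})"
      if "\<delta> < \<eta>" for \<eta> by (rule finite_measure_mono) (use that in auto)
    show "\<P>(w in M. X w \<in> {c - \<delta><..<c + \<delta>}) < e"
      using c mono[OF \<delta>(2)] mono[OF \<delta>(3)] \<eta>(2,4) by (auto intro: le_less_trans)
  qed
qed

text \<open>A piecewise linear minorant of the indicator of the open interval. For positive
  \<open>\<delta>\<close> it becomes a lower triangle if \<open>b - a < 2 * \<delta>\<close> and
  zero if \<open>b \<le> a\<close>, so one formula covers every choice of end points.\<close>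

definition trapezoid :: "real \<Rightarrow> real \<Rightarrow> real \<Rightarrow> real \<Rightarrow> real" where
  "trapezoid \<delta> a b t = max 0 (min 1 (min (t - a) (b - t) / \<delta>))"

lemma trapezoid_bounds: "0 \<le> trapezoid \<delta> a b t" "trapezoid \<delta> a b t \<le> 1"
  by (auto simp: trapezoid_def)

lemma uniformly_continuous_trapezoid:
  assumes "\<delta> > 0"
  shows "uniformly_continuous_on UNIV (trapezoid \<delta> a b)"
proof (rule lipschitz_on_uniformly_continuous, rule lipschitz_onI)
  fix s t :: real
  \<comment> \<open>Clamping to the unit interval does not increase distances.\<close>
  have "\<bar>trapezoid \<delta> a b s - trapezoid \<delta> a b t\<bar> \<le> \<bar>min (s - a) (b - s) / \<delta> - min (t - a) (b - t) / \<delta>\<bar>"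
    unfolding trapezoid_def by linarith
  also have "\<dots> = \<bar>min (s - a) (b - s) - min (t - a) (b - t)\<bar> / \<delta>"
    using assms by (simp add: diff_divide_distrib[symmetric] abs_divide)
  also have "\<dots> \<le> \<bar>s - t\<bar> / \<delta>"
    using assms by (intro divide_right_mono) linarith+
  finally show "dist (trapezoid \<delta> a b s) (trapezoid \<delta> a b t) \<le> 1 / \<delta> * dist s t"
    by (simp add: dist_real_def)
qed (use assms in simp)

text \<open>Outside the two windows both functions are \<open>0\<close> or both are
  \<open>1\<close>; inside, both lie between \<open>0\<close> and \<open>1\<close>, so the error is
  at most \<open>1\<close>.\<close>

lemma indicator_trapezoid_diff:
  assumes "\<delta> > 0"
  shows "\<bar>indicator {a<..<b} t - trapezoid \<delta> a b t\<bar>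
    \<le> indicator {a - \<delta><..<a + \<delta>} t + indicator {b - \<delta><..<b + \<delta>} t"
proof (cases "t \<in> {a - \<delta><..<a + \<delta>} \<union> {b - \<delta><..<b + \<delta>}")
  case True
  have "\<bar>indicator {a<..<b} t - trapezoid \<delta> a b t\<bar> \<le> 1"
    using trapezoid_bounds[of \<delta> a b t] by (auto simp: indicator_def)
  also have "1 \<le> (indicator {a - \<delta><..<a + \<delta>} t + indicator {b - \<delta><..<b + \<delta>} t :: real)"
    using True by (auto simp: indicator_def)
  finally show ?thesis .
next
  case False
  have "indicator {a<..<b} t = trapezoid \<delta> a b t"
  proof (cases "a < t \<and> t < b")
    case True
    with False have "min (t - a) (b - t) \<ge> \<delta>" using assms by auto
    then have "min (t - a) (b - t) / \<delta> \<ge> 1" using assms by (simp add: le_divide_eq)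
    then show ?thesis using True by (simp add: trapezoid_def)
  next
    case out: False
    then have "min (t - a) (b - t) / \<delta> \<le> 0" using assms by (intro divide_nonpos_pos) auto
    then show ?thesis using out by (simp add: trapezoid_def)
  qed
  then show ?thesis by simp
qed

section \<open>Growth statistics jointly with the base dynamics\<close>

theorem theorem1p11:
  fixes M :: "'a::metric_space measure"
    and T :: "'a \<Rightarrow> 'a"
    and C :: "'a \<Rightarrow> int \<Rightarrow> real^'m::finite^'m"
    and A\<^sub>N V :: "nat \<Rightarrow> real"
    and P :: "'w measure" and S :: "'w \<Rightarrow> real"
  defines "S\<^sub>N \<equiv> \<lambda>N x v. (log_growth C x v N - A\<^sub>N N) / V N"
    and "\<nu> \<equiv> (proj_measure :: 'm projective measure)"
  assumes "sets M = sets borel" and "prob_space M"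
    and "bij T" and "measure_preserving M T"
    and "measurable_cocycle M (int_iterate T) C"
    and "\<forall>N. V N > 0" and "filterlim V at_top sequentially"
    and "prob_space P" and "S \<in> borel_measurable P"
    and "\<forall>a b. \<P>(w in P. S w \<in> {a, b}) = 0 \<longrightarrow>
           (\<lambda>N. measure (M \<Otimes>\<^sub>M \<nu>) {(x, v). S\<^sub>N N x v \<in> {a<..<b}})
             \<longlonglongrightarrow> \<P>(w in P. S w \<in> {a<..<b})"
    and "sufficiently_bounded M T V C"
    and "simple_dominated_splitting M V C"
    and "\<exists>U (D :: 'a \<Rightarrow> nat \<Rightarrow> real^'m^'m).
           measure_preserving M U \<and> ergodic M U \<and>
           measurable_cocycle M (\<lambda>n. U ^^ n) D \<and>
           contracting M T U \<and> adapted M U V C D"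
  shows "\<forall>A\<in>sets borel. \<forall>B\<in>sets borel. \<forall>a b. \<P>(w in P. S w \<in> {a, b}) = 0 \<longrightarrow>
           (\<lambda>N. measure (M \<Otimes>\<^sub>M \<nu>)
                  {(x, v). x \<in> A \<and> S\<^sub>N N x v \<in> {a<..<b} \<and> (T ^^ N) x \<in> B})
             \<longlonglongrightarrow> measure M A * \<P>(w in P. S w \<in> {a<..<b}) * measure M B"
proof (intro ballI allI impI)
  fix A B :: "'a set" and a b :: real
  assume A': "A \<in> sets borel" and B': "B \<in> sets borel" and ab: "\<P>(w in P. S w \<in> {a, b}) = 0"
  note sets = \<open>sets M = sets borel\<close> and T = \<open>measure_preserving M T\<close>
    and C = \<open>measurable_cocycle M (int_iterate T) C\<close>
  have V: "V N > 0" for N using \<open>\<forall>N. V N > 0\<close> by blast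
  obtain U and D :: "'a \<Rightarrow> nat \<Rightarrow> real^'m^'m" where U: "measure_preserving M U" "ergodic M U"
    and D: "measurable_cocycle M (\<lambda>n. U ^^ n) D" and TU: "contracting M T U" and CD: "adapted M U V C D"
    using \<open>\<exists>U D. _ U D\<close> by blast
  interpret prob_space M by fact
  interpret \<nu>: prob_space \<nu> unfolding \<nu>_def by (rule prob_space_proj_measure)
  interpret PQ: pair_prob_space M \<nu> ..
  interpret P: prob_space P by fact
  have space: "space M = UNIV" using sets_eq_imp_space_eq[OF sets] by simp
  have space\<nu>: "space \<nu> = UNIV" by (simp add: \<nu>_def)
  have A [measurable]: "A \<in> sets M" and B [measurable]: "B \<in> sets M" using A' B' sets by auto
  have [measurable]: "T ^^ n \<in> measurable M M" for n
    by (rule measure_preservingD(1)[OF measure_preserving_funpow[OF T]])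
  have lg [measurable]: "(\<lambda>(x, v). log_growth C x v N) \<in> borel_measurable (M \<Otimes>\<^sub>M \<nu>)" for N
    unfolding \<nu>_def by (rule log_growth_measurable[OF C])
  have lgx: "(\<lambda>v. log_growth C x v N) \<in> borel_measurable \<nu>" for x N
    using measurable_compose[OF measurable_Pair1' lg, of x] by (simp add: space)
  let ?Q = "M \<Otimes>\<^sub>M \<nu>"
  define s where "s N z = S\<^sub>N N (fst z) (snd z)" for N and z :: "'a \<times> 'm projective"
  have [measurable]: "s N \<in> borel_measurable ?Q" for N
    using lg[of N] unfolding s_def S\<^sub>N_def by (simp add: split_beta')
  \<comment> \<open>The two conditions on the base point form a weight independent of the
    direction.\<close>
  define F where "F N z = (indicator A (fst z) * indicator B ((T ^^ N) (fst z)) :: real)" for N and z :: "'a \<times> 'm projective"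
  have [measurable]: "F N \<in> borel_measurable ?Q" for N unfolding F_def by measurable
  have F0: "0 \<le> F N z" and F1: "F N z \<le> 1" for N z by (simp_all add: F_def indicator_def)
  define m where "m N I = PQ.prob {(x, v). S\<^sub>N N x v \<in> I}" for N and I :: "real set"
  define p where "p I = \<P>(w in P. S w \<in> I)" for I
  define E where "E N = {(x, v). x \<in> A \<and> S\<^sub>N N x v \<in> {a<..<b} \<and> (T ^^ N) x \<in> B}" for N
  have m: "m N I = (\<integral>z. indicator I (s N z) \<partial>?Q)" if [measurable]: "I \<in> sets borel" for N I
  proof -
    have "{(x, v). S\<^sub>N N x v \<in> I} = {z \<in> space ?Q. s N z \<in> I}"
      by (auto simp: s_def space_pair_measure space space\<nu>)
    then have "m N I = (\<integral>z. indicator {z \<in> space ?Q. s N z \<in> I} z \<partial>?Q)"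
      by (simp add: m_def)
    also have "\<dots> = (\<integral>z. indicator I (s N z) \<partial>?Q)"
      by (rule Bochner_Integration.integral_cong) (auto simp: indicator_def)
    finally show ?thesis .
  qed
  have E: "PQ.prob (E N) = (\<integral>z. F N z * indicator {a<..<b} (s N z) \<partial>?Q)" for N
  proof -
    have "E N = {z \<in> space ?Q. fst z \<in> A \<and> s N z \<in> {a<..<b} \<and> (T ^^ N) (fst z) \<in> B}"
      by (auto simp: E_def s_def space_pair_measure space space\<nu>)
    moreover have "{z \<in> space ?Q. fst z \<in> A \<and> s N z \<in> {a<..<b} \<and> (T ^^ N) (fst z) \<in> B} \<in> sets ?Q"
      by measurable
    ultimately have "PQ.prob (E N)
        = (\<integral>z. indicator {z \<in> space ?Q. fst z \<in> A \<and> s N z \<in> {a<..<b} \<and> (T ^^ N) (fst z) \<in> B} z \<partial>?Q)"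
      by simp
    also have "\<dots> = (\<integral>z. F N z * indicator {a<..<b} (s N z) \<partial>?Q)"
      by (rule Bochner_Integration.integral_cong) (auto simp: F_def indicator_def)
    finally show ?thesis .
  qed
  have m_lim: "(\<lambda>N. m N {c<..<d}) \<longlonglongrightarrow> p {c<..<d}" if "p {c, d} = 0" for c d
    using that assms(12) unfolding m_def p_def by blast
  \<comment> \<open>The claim with a uniformly continuous \<open>g\<close> in place of the interval.
    Integrating out the direction first leaves functions on the base, to which
    \<open>asymptotic_independence\<close> applies.\<close>
  have smooth: "(\<lambda>N. (\<integral>z. F N z * g (s N z) \<partial>?Q) - prob A * prob B * (\<integral>z. g (s N z) \<partial>?Q)) \<longlonglongrightarrow> 0"
    if g: "uniformly_continuous_on UNIV g" and g1: "\<And>t. \<bar>g t\<bar> \<le> 1" for g :: "real \<Rightarrow> real"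
  proof -
    have [measurable]: "g \<in> borel_measurable borel"
      by (intro borel_measurable_continuous_onI uniformly_continuous_imp_continuous g)
    define h where "h N x = (\<integral>v. g (S\<^sub>N N x v) \<partial>\<nu>)" for N x
    have gs: "(\<lambda>(x, v). g (S\<^sub>N N x v)) \<in> borel_measurable ?Q" for N
      using measurable_compose[of "s N" ?Q borel g borel] by (simp add: s_def split_beta')
    have hm [measurable]: "h N \<in> borel_measurable M" for N
      unfolding h_def by (rule \<nu>.borel_measurable_lebesgue_integral[OF gs])
    have h1: "\<bar>h N x\<bar> \<le> 1" for N x
    proof -
      have [measurable]: "(\<lambda>v. g (S\<^sub>N N x v)) \<in> borel_measurable \<nu>"
        using lgx[of x N] unfolding S\<^sub>N_def by measurable
      have "\<bar>h N x\<bar> \<le> (\<integral>v. \<bar>g (S\<^sub>N N x v)\<bar> \<partial>\<nu>)" unfolding h_def by (rule integral_abs_bound)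
      also have "\<dots> \<le> (\<integral>v. 1 \<partial>\<nu>)"
        by (intro integral_mono \<nu>.integrable_bounded[where B = 1]) (auto intro: g1)
      finally show ?thesis by (simp add: \<nu>.prob_space)
    qed
    note split = \<open>simple_dominated_splitting M V C\<close>[unfolded simple_dominated_splitting_def]
    \<comment> \<open>One argument for both dynamics: the direction is moved by \<open>C x 1\<close>
      along \<open>T\<close> and by \<open>D x 1\<close> along \<open>U\<close>.\<close>
    have related: "AE x in M. (\<lambda>N. h N (W x) - h N x) \<longlonglongrightarrow> 0"
      if W: "measure_preserving M W" and R: "\<And>x. invertible (R x)"
        and close: "AE x in M. AE v in proj_measure.
          (\<lambda>N. \<bar>log_growth C x v N - log_growth C (W x) (proj_act (R x) v) N\<bar> / V N) \<longlonglongrightarrow> 0"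
      for W and R :: "'a \<Rightarrow> real^'m^'m"
      using close split measure_preserving_AE[OF W split]
    proof eventually_elim
      case (elim x)
      show ?case unfolding h_def S\<^sub>N_def \<nu>_def
        by (rule direction_averages_asymptotically_equal[OF R[of x] V _ _ g g1 elim])
          (use lgx in \<open>simp_all add: \<nu>_def\<close>)
    qed
    have hT: "AE x in M. (\<lambda>N. h N (T x) - h N x) \<longlonglongrightarrow> 0"
      by (rule related[OF T, of "\<lambda>x. C x 1"])
        (use C \<open>sufficiently_bounded M T V C\<close> in \<open>simp_all add: measurable_cocycle_def sufficiently_bounded_def space\<close>)
    have hU: "AE x in M. (\<lambda>N. h N (U x) - h N x) \<longlonglongrightarrow> 0"
      by (rule related[OF U(1), of "\<lambda>x. D x 1"])
        (use D CD in \<open>simp_all add: measurable_cocycle_def adapted_def space\<close>)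
    have "(\<lambda>N. (\<integral>x. indicator A x * h N x * indicator B ((T ^^ N) x) \<partial>M)
        - prob A * prob B * (\<integral>x. h N x \<partial>M)) \<longlonglongrightarrow> 0"
      by (rule asymptotic_independence[OF T _ U hm h1 hT hU A B])
        (use contracting_imp_ergodic[OF \<open>prob_space M\<close> sets T U TU]
          contracting_indicator_L1[OF \<open>prob_space M\<close> sets T U(1) TU B'] in auto)
    moreover have "(\<integral>x. h N x \<partial>M) = (\<integral>z. g (s N z) \<partial>?Q)" for N
    proof -
      have "integrable ?Q (\<lambda>(x, v). g (S\<^sub>N N x v))"
        by (rule PQ.integrable_bounded[OF gs, where B = 1]) (auto intro: g1)
      from PQ.integral_fst'[OF this] show ?thesis
        by (simp add: h_def s_def split_beta')
    qed
    moreover have "(\<integral>x. indicator A x * h N x * indicator B ((T ^^ N) x) \<partial>M) = (\<integral>z. F N z * g (s N z) \<partial>?Q)" for N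
    proof -
      have "integrable ?Q (\<lambda>z. F N z * g (s N z))"
      proof (rule PQ.integrable_bounded[where B = 1])
        show "\<bar>F N z * g (s N z)\<bar> \<le> 1" for z
          using mult_mono[of "F N z" 1 "\<bar>g (s N z)\<bar>" 1] F0[of N z] F1[of N z] g1[of "s N z"]
          by (simp add: abs_mult)
      qed measurable
      then have "integrable ?Q (\<lambda>(x, v). F N (x, v) * g (s N (x, v)))" by (simp add: split_beta')
      from PQ.integral_fst'[OF this]
      have "(\<integral>x. (\<integral>v. F N (x, v) * g (s N (x, v)) \<partial>\<nu>) \<partial>M) = (\<integral>z. F N z * g (s N z) \<partial>?Q)"
        by (simp add: split_beta')
      \<comment> \<open>The weight is constant in the direction and leaves the inner
        integral.\<close>
      moreover have "(\<integral>v. F N (x, v) * g (s N (x, v)) \<partial>\<nu>) = indicator A x * h N x * indicator B ((T ^^ N) x)" for x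
        by (simp add: F_def s_def h_def mult_ac)
      ultimately show ?thesis by simp
    qed
    ultimately show ?thesis by simp
  qed
  have atom: "P.prob {w \<in> space P. S w = c} = 0" if "c \<in> {a, b}" for c
  proof -
    have [measurable]: "S \<in> borel_measurable P" by fact
    have "P.prob {w \<in> space P. S w = c} \<le> P.prob {w \<in> space P. S w \<in> {a, b}}"
      by (rule P.finite_measure_mono) (use that in auto)
    then show ?thesis using ab by (simp add: measure_le_0_iff)
  qed
  have "(\<lambda>N. PQ.prob (E N)) \<longlonglongrightarrow> prob A * p {a<..<b} * prob B"
  proof (rule LIMSEQ_I)
    fix e :: real assume "e > 0"
    \<comment> \<open>Error budget: two trapezoid errors below \<open>e / 4\<close> each,
      \<open>e / 8\<close> from \<open>smooth\<close> and \<open>e / 8\<close> from the assumed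
      convergence add up to less than \<open>e\<close>.\<close>
    then have e8: "e / 8 > 0" by simp
    from P.small_radius_avoiding_atoms[OF \<open>S \<in> borel_measurable P\<close> e8 atom atom, of a b]
    obtain \<delta> where \<delta>: "\<delta> > 0" and \<delta>0: "\<And>c. c \<in> {a, b} \<Longrightarrow> p {c - \<delta>, c + \<delta>} = 0"
      and \<delta>e: "\<And>c. c \<in> {a, b} \<Longrightarrow> p {c - \<delta><..<c + \<delta>} < e / 8"
      unfolding p_def by blast
    let ?g = "trapezoid \<delta> a b"
    have g: "uniformly_continuous_on UNIV ?g" by (rule uniformly_continuous_trapezoid[OF \<delta>])
    have [measurable]: "?g \<in> borel_measurable borel"
      by (intro borel_measurable_continuous_onI uniformly_continuous_imp_continuous g)
    have g1: "\<bar>?g t\<bar> \<le> 1" for t using trapezoid_bounds[of \<delta> a b t] by simp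
    define r where "r N = m N {a - \<delta><..<a + \<delta>} + m N {b - \<delta><..<b + \<delta>}" for N
    \<comment> \<open>The weight \<open>G\<close> will be \<open>F N\<close> for the joint event and
      the constant \<open>1\<close> for the interval event alone.\<close>
    have close: "\<bar>(\<integral>z. G z * indicator {a<..<b} (s N z) \<partial>?Q) - (\<integral>z. G z * ?g (s N z) \<partial>?Q)\<bar> \<le> r N"
      if [measurable]: "G \<in> borel_measurable ?Q" and G: "\<And>z. 0 \<le> G z" "\<And>z. G z \<le> 1" for G N
    proof -
      have mult1: "\<bar>G z * t\<bar> \<le> \<bar>t\<bar>" for z t
        using G[of z] by (simp add: abs_mult mult_left_le_one_le)
      have i1: "integrable ?Q (\<lambda>z. G z * indicator {a<..<b} (s N z))"
        by (rule PQ.integrable_bounded[where B = 1], measurable)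
          (rule order_trans[OF mult1], simp add: indicator_def)
      have i2: "integrable ?Q (\<lambda>z. G z * ?g (s N z))"
        by (rule PQ.integrable_bounded[where B = 1], measurable) (rule order_trans[OF mult1 g1])
      have i3: "integrable ?Q (\<lambda>z. indicator {c<..<d} (s N z) :: real)" for c d
      proof (rule PQ.integrable_bounded[where B = 1])
        show "\<bar>indicator {c<..<d} (s N z)\<bar> \<le> (1 :: real)" for z by (simp add: indicator_def)
      qed measurable
      have "(\<integral>z. G z * indicator {a<..<b} (s N z) \<partial>?Q) - (\<integral>z. G z * ?g (s N z) \<partial>?Q)
          = (\<integral>z. G z * (indicator {a<..<b} (s N z) - ?g (s N z)) \<partial>?Q)"
        unfolding right_diff_distrib using i1 i2 by (rule Bochner_Integration.integral_diff[symmetric])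
      also have "\<bar>\<dots>\<bar> \<le> (\<integral>z. \<bar>G z * (indicator {a<..<b} (s N z) - ?g (s N z))\<bar> \<partial>?Q)"
        by (rule integral_abs_bound)
      also have "\<dots> \<le> (\<integral>z. indicator {a - \<delta><..<a + \<delta>} (s N z) + indicator {b - \<delta><..<b + \<delta>} (s N z) \<partial>?Q)"
      proof (rule integral_mono)
        show "integrable ?Q (\<lambda>z. \<bar>G z * (indicator {a<..<b} (s N z) - ?g (s N z))\<bar>)"
          unfolding right_diff_distrib by (intro integrable_abs Bochner_Integration.integrable_diff i1 i2)
        show "integrable ?Q (\<lambda>z. indicator {a - \<delta><..<a + \<delta>} (s N z) + indicator {b - \<delta><..<b + \<delta>} (s N z) :: real)"
          by (intro Bochner_Integration.integrable_add i3)
        show "\<bar>G z * (indicator {a<..<b} (s N z) - ?g (s N z))\<bar>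
          \<le> indicator {a - \<delta><..<a + \<delta>} (s N z) + indicator {b - \<delta><..<b + \<delta>} (s N z)" for z
          by (rule order_trans[OF mult1 indicator_trapezoid_diff[OF \<delta>]])
      qed
      also have "\<dots> = r N" by (simp add: r_def m i3)
      finally show ?thesis .
    qed
    \<comment> \<open>The end points of both windows are not atoms of \<open>S\<close>, so the
      assumed convergence in distribution applies to the windows themselves.\<close>
    have "r \<longlonglongrightarrow> p {a - \<delta><..<a + \<delta>} + p {b - \<delta><..<b + \<delta>}"
      unfolding r_def by (intro tendsto_add m_lim \<delta>0) auto
    moreover have "p {a - \<delta><..<a + \<delta>} + p {b - \<delta><..<b + \<delta>} < e / 4"
      using \<delta>e[of a] \<delta>e[of b] by simp
    ultimately have "eventually (\<lambda>N. r N < e / 4) sequentially" by (rule order_tendstoD(2))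
    moreover from tendstoD[OF smooth[OF g g1] e8]
    have "eventually (\<lambda>N. \<bar>(\<integral>z. F N z * ?g (s N z) \<partial>?Q) - prob A * prob B * (\<integral>z. ?g (s N z) \<partial>?Q)\<bar> < e / 8) sequentially"
      by (simp add: dist_real_def)
    moreover have "p {a, b} = 0" using ab by (simp add: p_def)
    from tendstoD[OF m_lim[OF this] e8]
    have "eventually (\<lambda>N. \<bar>m N {a<..<b} - p {a<..<b}\<bar> < e / 8) sequentially"
      by (simp add: dist_real_def)
    ultimately have "eventually (\<lambda>N. norm (PQ.prob (E N) - prob A * p {a<..<b} * prob B) < e) sequentially"
    proof eventually_elim
      case (elim N)
      define k where "k = prob A * prob B"
      have k: "0 \<le> k" "k \<le> 1" by (simp_all add: k_def mult_le_one)
      have scale: "\<bar>k * x - k * y\<bar> \<le> \<bar>x - y\<bar>" for x y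
        using k by (simp add: right_diff_distrib[symmetric] abs_mult mult_left_le_one_le)
      have "\<bar>PQ.prob (E N) - (\<integral>z. F N z * ?g (s N z) \<partial>?Q)\<bar> \<le> r N"
        unfolding E by (rule close) (auto intro: F0 F1)
      moreover have "\<bar>m N {a<..<b} - (\<integral>z. ?g (s N z) \<partial>?Q)\<bar> \<le> r N"
        using close[of "\<lambda>_. 1" N] by (simp add: m)
      ultimately have "\<bar>PQ.prob (E N) - k * p {a<..<b}\<bar> < e"
        using elim scale[of "m N {a<..<b}" "\<integral>z. ?g (s N z) \<partial>?Q"] scale[of "m N {a<..<b}" "p {a<..<b}"]
        unfolding k_def[symmetric] by linarith
      then show ?case by (simp add: k_def mult_ac)
    qed
    then show "\<exists>N0. \<forall>N\<ge>N0. norm (PQ.prob (E N) - prob A * p {a<..<b} * prob B) < e"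
      by (simp add: eventually_sequentially)
  qed
  then show "(\<lambda>N. measure (M \<Otimes>\<^sub>M \<nu>)
                  {(x, v). x \<in> A \<and> S\<^sub>N N x v \<in> {a<..<b} \<and> (T ^^ N) x \<in> B})
             \<longlonglongrightarrow> measure M A * \<P>(w in P. S w \<in> {a<..<b}) * measure M B"
    by (simp add: E_def p_def)
qed

end
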